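(* Suppose that $d\leq 2$. Then, for any $c \in \mathfrak{C}_+$ and $P \in \mathfrak{P}_+$ there exists a $Q \in \mathfrak{P}_+$ such that $d\mu=(P/Q)\,dm$ satisfies $$c_{\mathbf{k}}=\int_{\mathbb{T}^d}e^{i(\mathbf{k},\boldsymbol{\theta})}\,d\mu(\boldsymbol{\theta})\quad\text{for all }\mathbf{k}\in\Lambda.$$ Moreover, this $Q$ is the unique solution to the strictly convex optimization problem to minimize the functional $$\mathbb{J}_P(Q) = \langle c, q \rangle - \int_{\mathbb{T}^d} P(e^{i\boldsymbol{\theta}}) \log Q(e^{i\boldsymbol{\theta}})\, dm(\boldsymbol{\theta})$$ over all $Q\in\mathfrak{P}_+$.
   Context: Let $d\ge 1$, $\mathbb{T}=(-\pi,\pi]$, $\boldsymbol{\theta}=(\theta_1,\dots,\theta_d)$, $e^{i\boldsymbol{\theta}}=(e^{i\theta_1},\dots,e^{i\theta_d})$, $(\mathbf{k},\boldsymbol{\theta})=\sum_{j=1}^d k_j\theta_j$, and $dm(\boldsymbol{\theta})=(1/2\pi)^d\prod_{j=1}^d d\theta_j$. The index set $\Lambda\subset\mathbb{Z}^d$ is finite with $0\in\Lambda$ and $-\Lambda=\Lambda$. Trigonometric polynomials are $P(e^{i\boldsymbol{\theta}})=\sum_{\mathbf{k}\in\Lambda}p_{\mathbf{k}}e^{-i(\mathbf{k},\boldsymbol{\theta})}$ with $p_{-\mathbf{k}}=\bar p_{\mathbf{k}}$ (real valued), identified with their coefficient vector $p=(p_{\mathbf{k}})_{\mathbf{k}\in\Lambda}$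 (similarly $Q\leftrightarrow q$). $\mathfrak{P}_+$ is the convex cone of such polynomials that are positive for all $\boldsymbol{\theta}\in\mathbb{T}^d$; $\bar{\mathfrak{P}}_+$ is its closure (nonnegative polynomials). Sequences $c=(c_{\mathbf{k}})_{\mathbf{k}\in\Lambda}$ are complex with $c_{-\mathbf{k}}=\bar c_{\mathbf{k}}$; $\langle c,p\rangle=\sum_{\mathbf{k}\in\Lambda}c_{\mathbf{k}}\bar p_{\mathbf{k}}$. $\mathfrak{C}_+=\{c\mid\langle c,p\rangle>0\text{ for all }P\in\bar{\mathfrak{P}}_+\setminus\{0\}\}$. *)

theory Defs
  imports "HOL-Analysis.Analysis" "HOL-Analysis.Finite_Function_Topology"
begin

text \<open>
  A family indexed by a finite \<open>\<Lambda> \<subseteq> \<int>\<^sup>d\<close> is a finitely supported function on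
  \<^typ>\<open>int ^ 'd\<close> that vanishes off \<open>\<Lambda>\<close>.  Thus equal families on \<open>\<Lambda>\<close> are equal elements, and the
  real vector space structure and the norm are those of \<^theory>\<open>HOL-Analysis.Finite_Function_Topology\<close>;
  on families supported in \<open>\<Lambda>\<close> that norm gives the usual finite-dimensional topology.
\<close>

definition hermitian_coeffs :: "(int ^ 'd::finite) set \<Rightarrow> ((int ^ 'd) \<Rightarrow>\<^sub>0 complex) set" where
  "hermitian_coeffs \<Lambda> = {p. Poly_Mapping.keys p \<subseteq> \<Lambda> \<and>
     (\<forall>k\<in>\<Lambda>. Poly_Mapping.lookup p (- k) = cnj (Poly_Mapping.lookup p k))}"

definition torus :: "(real ^ 'd::finite) set" where
  "torus = {\<theta>. \<forall>j. \<theta> $ j \<in> {-pi<..pi}}"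

definition torus_measure :: "(real ^ 'd::finite) measure" where
  "torus_measure = density lborel (\<lambda>\<theta>. ennreal ((1 / (2 * pi)) ^ CARD('d)) * indicator torus \<theta>)"

definition freq :: "int ^ 'd::finite \<Rightarrow> real ^ 'd \<Rightarrow> real" where
  "freq k \<theta> = (\<Sum>j\<in>UNIV. of_int (k $ j) * \<theta> $ j)"

definition trig_poly ::
  "(int ^ 'd::finite) set \<Rightarrow> ((int ^ 'd) \<Rightarrow>\<^sub>0 complex) \<Rightarrow> real ^ 'd \<Rightarrow> complex" where
  "trig_poly \<Lambda> p \<theta> = (\<Sum>k\<in>\<Lambda>. Poly_Mapping.lookup p k * exp (- (\<i> * of_real (freq k \<theta>))))"

definition pairing ::
  "(int ^ 'd::finite) set \<Rightarrow> ((int ^ 'd) \<Rightarrow>\<^sub>0 complex) \<Rightarrow> ((int ^ 'd) \<Rightarrow>\<^sub>0 complex) \<Rightarrow> complex" where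
  "pairing \<Lambda> c p = (\<Sum>k\<in>\<Lambda>. Poly_Mapping.lookup c k * cnj (Poly_Mapping.lookup p k))"

text \<open>
  For Hermitian families and symmetric \<open>\<Lambda>\<close> both \<^const>\<open>trig_poly\<close> and \<^const>\<open>pairing\<close> are
  real (lemmas \<open>trig_poly_real\<close> and \<open>pairing_real\<close> below), so taking \<^const>\<open>Re\<close> loses nothing.
  The closure of \<open>pos_polys \<Lambda>\<close> is the set of nonnegative polynomials (lemma \<open>closure_pos_polys\<close>).
\<close>

definition pos_polys :: "(int ^ 'd::finite) set \<Rightarrow> ((int ^ 'd) \<Rightarrow>\<^sub>0 complex) set" where
  "pos_polys \<Lambda> = {p \<in> hermitian_coeffs \<Lambda>. \<forall>\<theta>\<in>torus. 0 < Re (trig_poly \<Lambda> p \<theta>)}"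

definition dual_cone :: "(int ^ 'd::finite) set \<Rightarrow> ((int ^ 'd) \<Rightarrow>\<^sub>0 complex) set" where
  "dual_cone \<Lambda> = {c \<in> hermitian_coeffs \<Lambda>.
     \<forall>p \<in> closure (pos_polys \<Lambda>) - {0}. 0 < Re (pairing \<Lambda> c p)}"

definition ratio_measure ::
  "(int ^ 'd::finite) set \<Rightarrow> ((int ^ 'd) \<Rightarrow>\<^sub>0 complex) \<Rightarrow> ((int ^ 'd) \<Rightarrow>\<^sub>0 complex) \<Rightarrow> (real ^ 'd) measure" where
  "ratio_measure \<Lambda> p q =
     density torus_measure (\<lambda>\<theta>. ennreal (Re (trig_poly \<Lambda> p \<theta>) / Re (trig_poly \<Lambda> q \<theta>)))"

definition dual_functional ::
  "(int ^ 'd::finite) set \<Rightarrow> ((int ^ 'd) \<Rightarrow>\<^sub>0 complex) \<Rightarrow> ((int ^ 'd) \<Rightarrow>\<^sub>0 complex) \<Rightarrow>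
    ((int ^ 'd) \<Rightarrow>\<^sub>0 complex) \<Rightarrow> real" where
  "dual_functional \<Lambda> c p q = Re (pairing \<Lambda> c q) -
     (LINT \<theta>|torus_measure. Re (trig_poly \<Lambda> p \<theta>) * ln (Re (trig_poly \<Lambda> q \<theta>)))"

definition strictly_convex_on :: "'a::real_vector set \<Rightarrow> ('a \<Rightarrow> real) \<Rightarrow> bool" where
  "strictly_convex_on S f \<longleftrightarrow> convex S \<and>
     (\<forall>x\<in>S. \<forall>y\<in>S. \<forall>u>0. \<forall>v>0. x \<noteq> y \<longrightarrow> u + v = 1 \<longrightarrow>
        f (u *\<^sub>R x + v *\<^sub>R y) < u * f x + v * f y)"

lemma freq_minus: "freq (- k) \<theta> = - freq k \<theta>"
  by (simp add: freq_def sum_negf)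

lemma trig_poly_real:
  assumes "uminus ` \<Lambda> = \<Lambda>" "p \<in> hermitian_coeffs \<Lambda>"
  shows "trig_poly \<Lambda> p \<theta> \<in> \<real>"
proof -
  have "trig_poly \<Lambda> p \<theta> =
      (\<Sum>k\<in>uminus ` \<Lambda>. Poly_Mapping.lookup p k * exp (- (\<i> * of_real (freq k \<theta>))))"
    using assms by (simp add: trig_poly_def)
  also have "\<dots> = (\<Sum>k\<in>\<Lambda>. Poly_Mapping.lookup p (- k) * exp (- (\<i> * of_real (freq (- k) \<theta>))))"
    by (subst sum.reindex) (auto simp: inj_on_def)
  also have "\<dots> = cnj (trig_poly \<Lambda> p \<theta>)"
    using assms unfolding trig_poly_def cnj_sum
    by (intro sum.cong) (auto simp: hermitian_coeffs_def freq_minus exp_cnj)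
  finally show ?thesis by (simp add: Reals_cnj_iff)
qed

lemma pairing_real:
  assumes "uminus ` \<Lambda> = \<Lambda>" "c \<in> hermitian_coeffs \<Lambda>" "p \<in> hermitian_coeffs \<Lambda>"
  shows "pairing \<Lambda> c p \<in> \<real>"
proof -
  have "pairing \<Lambda> c p =
      (\<Sum>k\<in>uminus ` \<Lambda>. Poly_Mapping.lookup c k * cnj (Poly_Mapping.lookup p k))"
    using assms by (simp add: pairing_def)
  also have "\<dots> = (\<Sum>k\<in>\<Lambda>. Poly_Mapping.lookup c (- k) * cnj (Poly_Mapping.lookup p (- k)))"
    by (subst sum.reindex) (auto simp: inj_on_def)
  also have "\<dots> = cnj (pairing \<Lambda> c p)"
    using assms unfolding pairing_def cnj_sum
    by (intro sum.cong) (auto simp: hermitian_coeffs_def)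
  finally show ?thesis by (simp add: Reals_cnj_iff)
qed

lemma norm_lookup_le: "norm (Poly_Mapping.lookup p k) \<le> norm (p :: 'a \<Rightarrow>\<^sub>0 'b::real_normed_vector)"
proof (cases "k \<in> Poly_Mapping.keys p")
  case True
  then show ?thesis
    unfolding norm_poly_mapping_def dist_poly_mapping_def
    by (simp add: member_le_sum[of k "Poly_Mapping.keys p" "\<lambda>n. norm (Poly_Mapping.lookup p n)"])
qed (simp add: in_keys_iff)

lemma continuous_on_lookup:
  "continuous_on UNIV (\<lambda>p :: 'a \<Rightarrow>\<^sub>0 'b::real_normed_vector. Poly_Mapping.lookup p k)"
proof -
  have "dist (Poly_Mapping.lookup x k) (Poly_Mapping.lookup y k) \<le> dist x y"
    for x y :: "'a \<Rightarrow>\<^sub>0 'b"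
    using norm_lookup_le[of "x - y" k] by (simp add: dist_norm lookup_minus)
  then show ?thesis
    unfolding continuous_on_iff by (meson le_less_trans)
qed

lemma lookup_scaleR:
  "Poly_Mapping.lookup (r *\<^sub>R (p :: 'a \<Rightarrow>\<^sub>0 'b::real_vector)) k = r *\<^sub>R Poly_Mapping.lookup p k"
proof -
  have "finite {i. r *\<^sub>R Poly_Mapping.lookup p i \<noteq> 0}"
    by (rule finite_subset[OF _ finite_lookup[of p]]) auto
  then show ?thesis
    by (simp add: scaleR_poly_mapping_def)
qed

lemma closure_pos_polys:
  assumes "finite \<Lambda>" "0 \<in> \<Lambda>"
  shows "closure (pos_polys \<Lambda>) =
    {p \<in> hermitian_coeffs \<Lambda>. \<forall>\<theta>\<in>torus. 0 \<le> Re (trig_poly \<Lambda> p \<theta>)}" (is "_ = ?N")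
proof
  have "?N = (\<Inter>k\<in>- \<Lambda>. {p. Poly_Mapping.lookup p k = 0}) \<inter>
     (\<Inter>k\<in>\<Lambda>. {p. Poly_Mapping.lookup p (- k) = cnj (Poly_Mapping.lookup p k)}) \<inter>
     (\<Inter>\<theta>\<in>torus. {p. 0 \<le> Re (trig_poly \<Lambda> p \<theta>)})"
    by (auto simp: hermitian_coeffs_def in_keys_iff subset_iff)
  also have "closed \<dots>"
    unfolding trig_poly_def
    by (intro closed_Int closed_INT ballI closed_Collect_eq closed_Collect_le
        continuous_intros continuous_on_lookup)
  finally have "closed ?N" .
  then show "closure (pos_polys \<Lambda>) \<subseteq> ?N"
    by (intro closure_minimal) (auto simp: pos_polys_def less_imp_le)
next
  show "?N \<subseteq> closure (pos_polys \<Lambda>)"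
  proof
    fix p assume p: "p \<in> ?N"
    define e :: "(int ^ 'a) \<Rightarrow>\<^sub>0 complex" where "e = Poly_Mapping.single 0 1"
    define f where "f n = p + inverse (real (Suc n)) *\<^sub>R e" for n
    have lk: "Poly_Mapping.lookup (f n) k =
        Poly_Mapping.lookup p k + (if k = 0 then of_real (inverse (real (Suc n))) else 0)" for n k
      by (simp add: f_def e_def lookup_add lookup_scaleR lookup_single when_def scaleR_conv_of_real del: single_one)
    have herm: "f n \<in> hermitian_coeffs \<Lambda>" for n
      using p assms(2) by (auto simp: hermitian_coeffs_def lk in_keys_iff subset_iff split: if_splits)
    have "trig_poly \<Lambda> (f n) \<theta> = trig_poly \<Lambda> p \<theta> + of_real (inverse (real (Suc n)))" for n \<theta>
    proof -
      have "trig_poly \<Lambda> (f n) \<theta> = trig_poly \<Lambda> p \<theta> +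
          (\<Sum>k\<in>\<Lambda>. if k = 0 then of_real (inverse (real (Suc n))) else 0)"
        unfolding trig_poly_def sum.distrib[symmetric]
        by (intro sum.cong) (auto simp: lk freq_def algebra_simps)
      then show ?thesis using assms by simp
    qed
    then have "f n \<in> pos_polys \<Lambda>" for n
      using herm[of n] p by (auto simp: pos_polys_def add_nonneg_pos simp del: of_nat_Suc)
    moreover have "f \<longlonglongrightarrow> p + 0 *\<^sub>R e"
      unfolding f_def by (intro tendsto_intros LIMSEQ_inverse_real_of_nat)
    ultimately show "p \<in> closure (pos_polys \<Lambda>)"
      by (auto simp: closure_sequential)
  qed
qed

end

theory Submission
  imports Defs
begin

text \<open>
  Write \<open>J\<close> for the functional and \<open>dJ\<close> for its formal derivative.  Integrating
  \<open>ln x \<le> x - 1\<close> gives \<open>J q - J r < dJ q (q - r)\<close> for \<open>q \<noteq> r\<close>; strict convexity, uniqueness and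
  the estimates along minimizing sequences all follow from this inequality.  Since \<open>\<langle>c, q\<rangle>\<close> dominates
  a multiple of \<open>norm q\<close>, a minimizing sequence has a limit point \<open>Q \<ge> 0\<close>.  If \<open>Q\<close> had a zero, it
  would vanish there quadratically, so for \<open>d \<le> 2\<close> the integral of \<open>P / (Q + \<delta>)\<close> would be
  arbitrarily large for small \<open>\<delta>\<close>, and adding \<open>\<delta>\<close> to late members of the sequence would push \<open>J\<close> below its infimum.
  Hence \<open>Q > 0\<close>, and the vanishing of \<open>dJ\<close> at \<open>Q\<close> is the moment condition.
\<close>

section \<open>Frequencies, trigonometric polynomials and the pairing\<close>

lemma freq_add: "freq k (x + y) = freq k x + freq k y"
  by (simp add: freq_def algebra_simps sum.distrib)

lemma freq_uminus: "freq k (- x) = - freq k x"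
  by (simp add: freq_def sum_negf)

lemma continuous_on_freq: "continuous_on S (freq k)"
  unfolding freq_def by (intro continuous_intros)

lemma freq_power2_le:
  assumes "\<And>j. \<bar>v $ j\<bar> \<le> r"
  shows "(freq k v)\<^sup>2 \<le> (\<Sum>j\<in>UNIV. \<bar>of_int (k $ j)\<bar>)\<^sup>2 * r\<^sup>2"
proof -
  have "\<bar>freq k v\<bar> \<le> (\<Sum>j\<in>UNIV. \<bar>of_int (k $ j) * v $ j\<bar>)"
    unfolding freq_def by (rule sum_abs)
  also have "\<dots> \<le> (\<Sum>j\<in>UNIV. \<bar>of_int (k $ j)\<bar> * r)"
    using assms by (intro sum_mono) (auto simp: abs_mult intro!: mult_left_mono)
  finally have "\<bar>freq k v\<bar> \<le> (\<Sum>j\<in>UNIV. \<bar>of_int (k $ j)\<bar>) * r"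
    by (simp add: sum_distrib_right)
  from power_mono[OF this, of 2] show ?thesis
    by (simp add: power_mult_distrib)
qed

text \<open>Half-angle formula: \<open>1 - cos x\<close> is twice the square of
  \<open>sin (x / 2)\<close>.\<close>

lemma one_minus_cos_le: "1 - cos x \<le> x\<^sup>2 / 2" for x :: real
proof -
  have "(sin (x / 2))\<^sup>2 \<le> (x / 2)\<^sup>2"
    using abs_sin_x_le_abs_x[of "x / 2"] unfolding abs_le_square_iff .
  then show ?thesis
    using cos_double_sin[of "x / 2"] by (simp add: power_divide)
qed

lemma continuous_on_trig_poly: "continuous_on S (trig_poly \<Lambda> p)"
  unfolding trig_poly_def by (intro continuous_intros continuous_on_freq)

lemma trig_poly_add: "trig_poly \<Lambda> (p + q) \<theta> = trig_poly \<Lambda> p \<theta> + trig_poly \<Lambda> q \<theta>"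
  by (simp add: trig_poly_def lookup_add algebra_simps sum.distrib)

lemma trig_poly_diff: "trig_poly \<Lambda> (p - q) \<theta> = trig_poly \<Lambda> p \<theta> - trig_poly \<Lambda> q \<theta>"
  by (simp add: trig_poly_def lookup_minus algebra_simps sum_subtractf)

lemma trig_poly_scaleR: "trig_poly \<Lambda> (r *\<^sub>R p) \<theta> = r *\<^sub>R trig_poly \<Lambda> p \<theta>"
  by (simp add: trig_poly_def lookup_scaleR scaleR_right.sum)

lemma pairing_add: "pairing \<Lambda> c (p + q) = pairing \<Lambda> c p + pairing \<Lambda> c q"
  by (simp add: pairing_def lookup_add algebra_simps sum.distrib)

lemma pairing_diff: "pairing \<Lambda> c (p - q) = pairing \<Lambda> c p - pairing \<Lambda> c q"
  by (simp add: pairing_def lookup_minus algebra_simps sum_subtractf)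

lemma pairing_scaleR: "pairing \<Lambda> c (r *\<^sub>R p) = r *\<^sub>R pairing \<Lambda> c p"
  by (simp add: pairing_def lookup_scaleR scaleR_right.sum)

lemma continuous_on_pairing: "continuous_on S (pairing \<Lambda> c)"
  unfolding pairing_def
  by (intro continuous_intros continuous_on_subset[OF continuous_on_lookup]) auto

section \<open>Norm and compactness of coefficient families\<close>

lemma norm_poly_mapping_eq_sum:
  fixes p :: "'a \<Rightarrow>\<^sub>0 'b::real_normed_vector"
  assumes "finite \<Lambda>" "Poly_Mapping.keys p \<subseteq> \<Lambda>"
  shows "norm p = (\<Sum>k\<in>\<Lambda>. norm (Poly_Mapping.lookup p k))"
proof -
  have "norm p = (\<Sum>k\<in>Poly_Mapping.keys p. norm (Poly_Mapping.lookup p k))"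
    by (simp add: norm_poly_mapping_def dist_poly_mapping_def)
  also have "\<dots> = (\<Sum>k\<in>\<Lambda>. norm (Poly_Mapping.lookup p k))"
    using assms by (intro sum.mono_neutral_left) (auto simp: in_keys_iff)
  finally show ?thesis .
qed

lemma norm_trig_poly_le:
  assumes "finite \<Lambda>" "Poly_Mapping.keys p \<subseteq> \<Lambda>"
  shows "norm (trig_poly \<Lambda> p \<theta>) \<le> norm p"
proof -
  have "norm (trig_poly \<Lambda> p \<theta>) \<le>
      (\<Sum>k\<in>\<Lambda>. norm (Poly_Mapping.lookup p k * exp (- (\<i> * of_real (freq k \<theta>)))))"
    unfolding trig_poly_def by (rule norm_sum)
  also have "\<dots> = norm p"
    using norm_poly_mapping_eq_sum[OF assms] by (simp add: norm_mult)
  finally show ?thesis .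
qed

text \<open>Over an infinite index type the whole space is infinite-dimensional, so compactness must
  come from the finite support. The bound is put on each coefficient, which turns the set into a
  product of balls and lets an induction split off one index at a time.\<close>

lemma compact_bounded_poly_mapping:
  fixes R :: real
  assumes "finite \<Lambda>"
  shows "compact {p :: 'a \<Rightarrow>\<^sub>0 'b::euclidean_space.
    Poly_Mapping.keys p \<subseteq> \<Lambda> \<and> (\<forall>k. norm (Poly_Mapping.lookup p k) \<le> R)}" (is "compact (?K \<Lambda>)")
  using assms
proof (induction \<Lambda>)
  case empty
  have "?K {} \<subseteq> {0}" by auto
  then show ?case by (rule finite_imp_compact[OF finite_subset]) simp
next
  case (insert l S)
  let ?f = "\<lambda>(z, p). Poly_Mapping.single l z + p"
  have dist: "dist (Poly_Mapping.single l x) (Poly_Mapping.single l y) = dist x y" for x y :: 'b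
    unfolding dist_norm single_diff[symmetric]
    by (simp add: norm_poly_mapping_def dist_poly_mapping_def)
  have single: "continuous_on UNIV (Poly_Mapping.single l :: 'b \<Rightarrow> _)"
    unfolding continuous_on_iff dist by blast
  have "continuous_on ((cball 0 R :: 'b set) \<times> ?K S) (\<lambda>x. Poly_Mapping.single l (fst x))"
    by (rule continuous_on_compose2[OF single]) (auto intro: continuous_intros)
  then have "continuous_on (cball 0 R \<times> ?K S) ?f"
    unfolding case_prod_unfold by (intro continuous_on_add continuous_on_snd continuous_on_id)
  then have "compact (?f ` (cball 0 R \<times> ?K S))"
    using insert by (intro compact_continuous_image compact_Times) auto
  moreover have "?K (insert l S) \<subseteq> ?f ` (cball 0 R \<times> ?K S)"
  proof
    fix p assume p: "p \<in> ?K (insert l S)"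
    define z where "z = Poly_Mapping.lookup p l"
    define q where "q = p - Poly_Mapping.single l z"
    have lq: "Poly_Mapping.lookup q k = (if k = l then 0 else Poly_Mapping.lookup p k)" for k
      by (simp add: q_def z_def lookup_minus lookup_single when_def)
    \<comment> \<open>For negative \<open>R\<close> the set is empty. Here \<open>p\<close> forces
      \<open>R\<close> to be nonnegative, which the new zero coefficient of \<open>q\<close> at
      \<open>l\<close> requires.\<close>
    have "norm (Poly_Mapping.lookup p l) \<le> R" using p by simp
    then have "0 \<le> R" using norm_ge_zero order_trans by blast
    then have "q \<in> ?K S"
      using p by (auto simp: lq in_keys_iff subset_iff split: if_splits)
    moreover have "p = ?f (z, q)" by (simp add: q_def)
    moreover have "z \<in> cball 0 R" using p by (simp add: z_def)
    ultimately show "p \<in> ?f ` (cball 0 R \<times> ?K S)" by blast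
  qed
  \<comment> \<open>With closedness, one inclusion into the compact image is enough.\<close>
  moreover have "closed (?K (insert l S))"
  proof -
    have "?K (insert l S) = (\<Inter>k\<in>- insert l S. {p. Poly_Mapping.lookup p k = 0}) \<inter>
        (\<Inter>k. {p. norm (Poly_Mapping.lookup p k) \<le> R})"
      by (auto simp: in_keys_iff subset_iff)
    then show ?thesis
      by (auto intro!: closed_Int closed_INT closed_Collect_eq closed_Collect_le
          continuous_intros continuous_on_lookup)
  qed
  ultimately have "compact (?f ` (cball 0 R \<times> ?K S) \<inter> ?K (insert l S))"
    by (intro compact_Int_closed)
  then show ?case
    using \<open>?K (insert l S) \<subseteq> _\<close> by (simp only: Int_absorb1)
qed

section \<open>Periodicity, positivity and linear independence\<close>

text \<open>Positivity is stipulated on the half-open cube only, while translations and continuity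
  arguments use all of the space. Integer frequencies make every character periodic with period
  \<open>2 * pi\<close> in each coordinate.\<close>

lemma torus_representative:
  fixes \<theta> :: "real ^ 'd::finite"
  obtains \<phi> where "\<phi> \<in> torus" "\<And>\<Lambda> p. trig_poly \<Lambda> p \<phi> = trig_poly \<Lambda> p \<theta>"
proof -
  \<comment> \<open>The ceiling, rather than the floor, matches the interval that is open at
    \<open>- pi\<close> and closed at \<open>pi\<close>.\<close>
  define n where "n j = \<lceil>(\<theta> $ j - pi) / (2 * pi)\<rceil>" for j
  define \<phi> :: "real ^ 'd" where "\<phi> = (\<chi> j. \<theta> $ j - 2 * pi * of_int (n j))"
  have "\<phi> $ j \<in> {-pi<..pi}" for j
  proof -
    have "(\<theta> $ j - pi) / (2 * pi) \<le> of_int (n j)" "of_int (n j) < (\<theta> $ j - pi) / (2 * pi) + 1"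
      unfolding n_def by linarith+
    then show ?thesis by (simp add: \<phi>_def field_simps)
  qed
  then have "\<phi> \<in> torus" by (simp add: torus_def)
  moreover have "exp (- (\<i> * of_real (freq k \<phi>))) = exp (- (\<i> * of_real (freq k \<theta>)))" for k
  proof -
    define N where "N = (\<Sum>j\<in>UNIV. k $ j * n j)"
    have eq: "freq k \<phi> = freq k \<theta> - 2 * pi * of_int N"
      by (simp add: N_def freq_def \<phi>_def algebra_simps sum_subtractf sum_distrib_left)
    have "- (\<i> * of_real (freq k \<phi>)) = - (\<i> * of_real (freq k \<theta>)) +
        of_real (of_int (2 * N) * pi) * \<i>"
      unfolding eq by (simp add: algebra_simps)
    then show ?thesis unfolding exp_eq by blast
  qed
  ultimately show ?thesis using that by (simp add: trig_poly_def)
qed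

lemma trig_poly_pos_everywhere:
  assumes "p \<in> pos_polys \<Lambda>"
  shows "0 < Re (trig_poly \<Lambda> p \<theta>)"
proof -
  obtain \<phi> where "\<phi> \<in> torus" "trig_poly \<Lambda> p \<phi> = trig_poly \<Lambda> p \<theta>"
    using torus_representative[of \<theta>] by metis
  then show ?thesis using assms by (auto simp: pos_polys_def)
qed

text \<open>The cube \<open>torus\<close> is not compact, so the minimum is taken over its closure;
  by periodicity it bounds the polynomial everywhere.\<close>

lemma pos_polys_lower_bound:
  fixes \<Lambda> :: "(int ^ 'd::finite) set"
  assumes "p \<in> pos_polys \<Lambda>"
  obtains m where "0 < m" "\<And>\<theta>. m \<le> Re (trig_poly \<Lambda> p \<theta>)"
proof -
  define K :: "(real ^ 'd) set" where "K = cbox (\<chi> j. - pi) (\<chi> j. pi)"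
  have sub: "torus \<subseteq> K"
    by (auto simp: K_def torus_def mem_box_cart less_imp_le)
  have "0 \<in> K" by (simp add: K_def mem_box_cart)
  moreover have "continuous_on K (\<lambda>\<theta>. Re (trig_poly \<Lambda> p \<theta>))"
    by (intro continuous_intros continuous_on_trig_poly)
  ultimately obtain x where "x \<in> K" and x: "\<And>\<theta>. \<theta> \<in> K \<Longrightarrow> Re (trig_poly \<Lambda> p x) \<le> Re (trig_poly \<Lambda> p \<theta>)"
    using continuous_attains_inf[of K "\<lambda>\<theta>. Re (trig_poly \<Lambda> p \<theta>)"] by (auto simp: K_def)
  have "Re (trig_poly \<Lambda> p x) \<le> Re (trig_poly \<Lambda> p \<theta>)" for \<theta>
    using x sub torus_representative[of \<theta>] by (metis subsetD)
  then show ?thesis using that trig_poly_pos_everywhere[OF assms] by blast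
qed

text \<open>Dedekind's argument for the linear independence of characters.\<close>

lemma characters_independent:
  fixes a :: "int ^ 'd::finite \<Rightarrow> complex"
  assumes "finite S" "\<And>\<theta>. (\<Sum>k\<in>S. a k * exp (- (\<i> * of_real (freq k \<theta>)))) = 0" "k \<in> S"
  shows "a k = 0"
  using assms
proof (induction S arbitrary: a k)
  case (insert l S)
  define ch where "ch k \<theta> = exp (- (\<i> * complex_of_real (freq k \<theta>)))" for k :: "int ^ 'd" and \<theta>
  have mult: "ch k (\<theta> + \<phi>) = ch k \<theta> * ch k \<phi>" for k \<theta> \<phi>
    by (simp add: ch_def freq_add algebra_simps flip: exp_add)
  have zero: "a l * ch l \<theta> + (\<Sum>k\<in>S. a k * ch k \<theta>) = 0" for \<theta>
    using insert.prems(1)[of \<theta>] insert.hyps by (simp add: ch_def)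
  have S: "a k = 0" if k: "k \<in> S" for k
  proof -
    have "k \<noteq> l" using k insert.hyps by auto
    then obtain j where j: "k $ j \<noteq> l $ j" by (auto simp: vec_eq_iff)
    \<comment> \<open>This translation makes the phases of the characters \<open>k\<close> and
      \<open>l\<close> differ by exactly \<open>pi\<close>, so that the two take opposite nonzero
      values at \<open>\<phi>\<close>.\<close>
    define \<phi> :: "real ^ 'd" where "\<phi> = axis j (pi / of_int (k $ j - l $ j))"
    have freq: "freq i \<phi> = of_int (i $ j) * (pi / of_int (k $ j - l $ j))" for i
      by (simp add: freq_def \<phi>_def axis_def if_distrib[where f = "\<lambda>x. _ * x"] cong: if_cong)
    have "freq k \<phi> = freq l \<phi> + pi"
      using j by (simp add: freq field_simps)
    then have "ch k \<phi> = - ch l \<phi>"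
      by (simp add: ch_def algebra_simps exp_diff exp_minus divide_inverse)
    moreover have "ch l \<phi> \<noteq> 0" by (simp add: ch_def)
    ultimately have "ch k \<phi> - ch l \<phi> \<noteq> 0" by simp
    moreover have "a k * (ch k \<phi> - ch l \<phi>) = 0"
    proof (rule insert.IH[OF _ k])
      fix \<theta>
      \<comment> \<open>The relation at \<open>\<theta> + \<phi>\<close> minus
        \<open>ch l \<phi>\<close> times the relation at \<open>\<theta>\<close> has no term for
        \<open>l\<close> any more, so the induction hypothesis applies.\<close>
      have "(\<Sum>k\<in>S. a k * (ch k \<phi> - ch l \<phi>) * ch k \<theta>) =
          (\<Sum>k\<in>S. a k * ch k (\<theta> + \<phi>)) - ch l \<phi> * (\<Sum>k\<in>S. a k * ch k \<theta>)"
        by (simp add: mult sum_distrib_left sum_subtractf[symmetric] algebra_simps)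
      also have "\<dots> = - a l * ch l (\<theta> + \<phi>) + ch l \<phi> * (a l * ch l \<theta>)"
        using zero[of "\<theta> + \<phi>"] zero[of \<theta>] by (simp add: add_eq_0_iff algebra_simps)
      also have "\<dots> = 0" by (simp add: mult)
      finally show "(\<Sum>k\<in>S. a k * (ch k \<phi> - ch l \<phi>) * exp (- (\<i> * of_real (freq k \<theta>)))) = 0"
        by (simp add: ch_def)
    qed
    ultimately show ?thesis by simp
  qed
  moreover have "a l = 0"
    using zero[of 0] S by (simp add: ch_def)
  ultimately show ?case using insert.prems(2) by auto
qed auto

lemma trig_poly_eq_0_imp:
  assumes "finite \<Lambda>" "Poly_Mapping.keys p \<subseteq> \<Lambda>" "\<And>\<theta>. trig_poly \<Lambda> p \<theta> = 0"
  shows "p = 0"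
proof (rule poly_mapping_eqI)
  fix k
  show "Poly_Mapping.lookup p k = Poly_Mapping.lookup 0 k"
    using characters_independent[OF assms(1), of "Poly_Mapping.lookup p" k] assms
    by (cases "k \<in> \<Lambda>") (auto simp: trig_poly_def in_keys_iff)
qed

section \<open>The normalized measure on the torus and small boxes inside it\<close>

lemma borel_torus: "torus \<in> sets borel"
proof -
  have "torus = (\<Inter>j. {\<theta>. - pi < \<theta> $ j} \<inter> {\<theta>. \<theta> $ j \<le> pi})"
    by (auto simp: torus_def)
  also have "\<dots> \<in> sets borel"
    by (intro sets.finite_INT sets.Int borel_open borel_closed open_Collect_less
        closed_Collect_le continuous_intros) auto
  finally show ?thesis .
qed

lemma sets_torus_measure [simp, measurable_cong]: "sets torus_measure = sets borel"
  by (simp add: torus_measure_def)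

lemma space_torus_measure [simp]: "space torus_measure = UNIV"
  by (simp add: torus_measure_def)

lemma emeasure_torus_measure:
  fixes A :: "(real ^ 'd::finite) set"
  assumes [measurable]: "A \<in> sets borel"
  shows "emeasure torus_measure A = ennreal ((1 / (2 * pi)) ^ CARD('d)) * emeasure lborel (A \<inter> torus)"
proof -
  have [measurable]: "(torus :: (real ^ 'd) set) \<in> sets borel" by (rule borel_torus)
  have "emeasure torus_measure A =
      (\<integral>\<^sup>+ \<theta>. ennreal ((1 / (2 * pi)) ^ CARD('d)) * indicator torus \<theta> * indicator A \<theta> \<partial>lborel)"
    unfolding torus_measure_def by (subst emeasure_density) auto
  also have "\<dots> = (\<integral>\<^sup>+ \<theta>. ennreal ((1 / (2 * pi)) ^ CARD('d)) * indicator (A \<inter> torus) \<theta> \<partial>lborel)"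
    by (intro nn_integral_cong) (auto split: split_indicator)
  also have "\<dots> = ennreal ((1 / (2 * pi)) ^ CARD('d)) * emeasure lborel (A \<inter> torus)"
    by (subst nn_integral_cmult_indicator) auto
  finally show ?thesis .
qed

lemma finite_measure_torus: "finite_measure (torus_measure :: (real ^ 'd::finite) measure)"
proof
  have "torus \<subseteq> cbox (\<chi> j. - pi) (\<chi> j. pi :: (real, 'd) vec)"
    by (auto simp: torus_def mem_box_cart less_imp_le)
  then have "emeasure lborel (torus :: (real ^ 'd) set) \<le> emeasure lborel (cbox (\<chi> j. - pi) (\<chi> j. pi :: (real, 'd) vec))"
    by (intro emeasure_mono) auto
  also have "\<dots> < \<infinity>"
    by (rule emeasure_lborel_cbox_finite)
  finally show "emeasure torus_measure (space (torus_measure :: (real ^ 'd) measure)) \<noteq> \<infinity>"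
    by (simp add: emeasure_torus_measure ennreal_mult_eq_top_iff)
qed

lemma borel_measurable_torus_measure:
  assumes "continuous_on UNIV f"
  shows "f \<in> borel_measurable torus_measure"
  using borel_measurable_continuous_onI[OF assms]
  by (simp only: measurable_cong_sets[OF sets_torus_measure refl])

text \<open>The measure is finite and concentrated on a bounded cube, on whose closure a continuous
  function is bounded.\<close>

lemma integrable_torus:
  fixes f :: "real ^ 'd::finite \<Rightarrow> 'b::{banach, second_countable_topology}"
  assumes f: "continuous_on UNIV f"
  shows "integrable torus_measure f"
proof -
  define K :: "(real ^ 'd) set" where "K = cbox (\<chi> j. - pi) (\<chi> j. pi)"
  have "compact (f ` K)"
    by (rule compact_continuous_image[OF continuous_on_subset[OF f subset_UNIV]])
      (simp add: K_def)
  then have "bounded (f ` K)" by (rule compact_imp_bounded)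
  then obtain B where B: "\<And>\<theta>. \<theta> \<in> K \<Longrightarrow> norm (f \<theta>) \<le> B"
    by (auto simp: bounded_iff)
  have [measurable]: "(torus :: (real ^ 'd) set) \<in> sets borel" by (rule borel_torus)
  have "AE \<theta> in torus_measure. norm (f \<theta>) \<le> B"
    unfolding torus_measure_def
    by (subst AE_density) (auto intro!: AE_I2 B simp: K_def torus_def mem_box_cart less_imp_le split: split_indicator)
  then show ?thesis
    by (rule finite_measure.integrable_const_bound[OF finite_measure_torus])
      (rule borel_measurable_torus_measure[OF f])
qed

text \<open>A point of \<open>torus\<close> may lie on its boundary, so the box extends from it towards the origin.\<close>

definition corner_box :: "real ^ 'd::finite \<Rightarrow> real \<Rightarrow> (real ^ 'd) set" where
  "corner_box \<theta> r = cbox (\<chi> j. if \<theta> $ j > 0 then \<theta> $ j - r else \<theta> $ j)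
                         (\<chi> j. if \<theta> $ j > 0 then \<theta> $ j else \<theta> $ j + r)"

lemma borel_corner_box [measurable]: "corner_box \<theta> r \<in> sets borel"
  by (simp add: corner_box_def)

lemma corner_box_coordinate:
  assumes "\<phi> \<in> corner_box \<theta> r"
  shows "\<bar>(\<phi> - \<theta>) $ j\<bar> \<le> r"
  using assms unfolding corner_box_def mem_box_cart
  by (auto simp: abs_le_iff split: if_splits dest!: spec[of _ j])

text \<open>As \<open>r \<le> 1 < pi\<close>, a positive coordinate lowered by at most
  \<open>r\<close> stays above \<open>- pi\<close>, and a nonpositive one raised by at most
  \<open>r\<close> stays below \<open>pi\<close>.\<close>

lemma corner_box_subset_torus:
  assumes "\<theta> \<in> torus" "r \<le> 1"
  shows "corner_box \<theta> r \<subseteq> torus"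
proof
  fix \<phi> assume "\<phi> \<in> corner_box \<theta> r"
  then have "(if \<theta> $ j > 0 then \<theta> $ j - r else \<theta> $ j) \<le> \<phi> $ j \<and>
      \<phi> $ j \<le> (if \<theta> $ j > 0 then \<theta> $ j else \<theta> $ j + r)" for j
    by (simp add: corner_box_def mem_box_cart)
  moreover have "- pi < \<theta> $ j \<and> \<theta> $ j \<le> pi" for j
    using assms by (simp add: torus_def)
  ultimately have "- pi < \<phi> $ j \<and> \<phi> $ j \<le> pi" for j
    using assms(2) pi_gt3 by (smt (verit))
  then show "\<phi> \<in> torus" by (simp add: torus_def)
qed

lemma measure_corner_box:
  fixes \<theta> :: "real ^ 'd::finite"
  assumes "\<theta> \<in> torus" "0 \<le> r" "r \<le> 1"
  shows "measure torus_measure (corner_box \<theta> r) = (1 / (2 * pi)) ^ CARD('d) * r ^ CARD('d)"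
proof -
  have "cbox (\<chi> j. if \<theta> $ j > 0 then \<theta> $ j - r else \<theta> $ j)
      (\<chi> j. if \<theta> $ j > 0 then \<theta> $ j else \<theta> $ j + r) \<noteq> {}"
    using assms(2) by (auto simp: interval_ne_empty_cart)
  then have "measure lborel (corner_box \<theta> r) =
      (\<Prod>j\<in>UNIV. (if \<theta> $ j > 0 then \<theta> $ j else \<theta> $ j + r) - (if \<theta> $ j > 0 then \<theta> $ j - r else \<theta> $ j))"
    unfolding corner_box_def by (subst content_cbox_cart) auto
  also have "\<dots> = (\<Prod>j\<in>(UNIV :: 'd set). r)"
    by (intro prod.cong) auto
  finally have "measure lborel (corner_box \<theta> r) = r ^ CARD('d)" by simp
  moreover have "corner_box \<theta> r \<inter> torus = corner_box \<theta> r"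
    using corner_box_subset_torus[OF assms(1,3)] by auto
  ultimately show ?thesis
    by (simp add: measure_def emeasure_torus_measure enn2real_mult)
qed

text \<open>By continuity \<open>f\<close> exceeds half of \<open>f \<theta>\<close> on a small
  corner box at \<open>\<theta>\<close>, and this box has positive measure even when
  \<open>\<theta>\<close> lies on the boundary of the cube.\<close>

lemma integral_torus_pos:
  fixes f :: "real ^ 'd::finite \<Rightarrow> real"
  assumes f: "continuous_on UNIV f" "\<And>\<theta>. 0 \<le> f \<theta>"
    and \<theta>: "\<theta> \<in> torus" "0 < f \<theta>"
  shows "0 < integral\<^sup>L torus_measure f"
proof -
  have "\<forall>e>0. \<exists>d>0. \<forall>\<phi>. dist \<phi> \<theta> < d \<longrightarrow> dist (f \<phi>) (f \<theta>) < e"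
    using f(1) by (simp add: continuous_on_iff)
  then obtain d where d: "0 < d" "\<And>\<phi>. dist \<phi> \<theta> < d \<Longrightarrow> dist (f \<phi>) (f \<theta>) < f \<theta> / 2"
    using \<theta>(2) by (meson half_gt_zero)
  \<comment> \<open>The Euclidean norm is at most the sum of the coordinates, hence at most
    \<open>CARD('d) * r\<close>; the factor 2 makes the inequality strict.\<close>
  define r where "r = min 1 (d / (2 * CARD('d)))"
  have r: "0 < r" "r \<le> 1" "r * CARD('d) < d"
    using d(1) by (auto simp: r_def min_def field_simps split: if_splits)
  have lower: "f \<theta> / 2 * indicator (corner_box \<theta> r) \<phi> \<le> f \<phi>" for \<phi>
  proof (cases "\<phi> \<in> corner_box \<theta> r")
    case True
    have "norm (\<phi> - \<theta>) \<le> (\<Sum>j\<in>UNIV. \<bar>(\<phi> - \<theta>) $ j\<bar>)"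
      by (rule norm_le_l1_cart)
    also have "\<dots> \<le> (\<Sum>j\<in>(UNIV::'d set). r)"
      using corner_box_coordinate[OF True] by (intro sum_mono) auto
    finally have "dist \<phi> \<theta> < d" using r(3) by (simp add: dist_norm mult.commute)
    from d(2)[OF this] have "- (f \<theta> / 2) < f \<phi> - f \<theta>"
      unfolding dist_real_def abs_less_iff by linarith
    then show ?thesis using True by simp
  qed (simp add: f(2))
  interpret finite_measure "torus_measure :: (real ^ 'd) measure"
    by (rule finite_measure_torus)
  have "0 < f \<theta> / 2 * measure torus_measure (corner_box \<theta> r)"
    using \<theta> r by (simp add: measure_corner_box)
  also have "\<dots> = (LINT \<phi>|torus_measure. f \<theta> / 2 * indicator (corner_box \<theta> r) \<phi>)"
    by simp
  also have "\<dots> \<le> integral\<^sup>L torus_measure f"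
  proof (rule integral_mono)
    show "integrable torus_measure (\<lambda>\<phi>. f \<theta> / 2 * indicator (corner_box \<theta> r) \<phi>)"
      by (intro integrable_mult_right integrable_real_indicator) (auto simp: less_top[symmetric])
  qed (use lower f(1) in \<open>auto intro: integrable_torus\<close>)
  finally show ?thesis .
qed

section \<open>Zeros of nonnegative polynomials and the reciprocal integral\<close>

text \<open>A symmetric second difference replaces the argument that the gradient vanishes at a
  minimum. The value at \<open>\<theta> - v\<close> is nonnegative and the value at
  \<open>\<theta>\<close> is zero, so the value at \<open>\<theta> + v\<close> is at most the second
  difference. There each character contributes the factor \<open>2 * cos (freq k v) - 2\<close>,
  which is quadratically small.\<close>

lemma trig_poly_quadratic_at_zero:
  fixes \<Lambda> :: "(int ^ 'd::finite) set"
  assumes nonneg: "\<And>\<theta>. 0 \<le> Re (trig_poly \<Lambda> q \<theta>)"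
    and zero: "Re (trig_poly \<Lambda> q \<theta>) = 0"
    and v: "\<And>j. \<bar>v $ j\<bar> \<le> r"
  shows "Re (trig_poly \<Lambda> q (\<theta> + v)) \<le>
    (\<Sum>k\<in>\<Lambda>. norm (Poly_Mapping.lookup q k) * (\<Sum>j\<in>UNIV. \<bar>of_int (k $ j)\<bar>)\<^sup>2) * r\<^sup>2"
proof -
  define w where "w k = Poly_Mapping.lookup q k * exp (- (\<i> * of_real (freq k \<theta>)))" for k
  have shift: "trig_poly \<Lambda> q (\<theta> + u) = (\<Sum>k\<in>\<Lambda>. w k * exp (- (\<i> * of_real (freq k u))))" for u
    by (simp add: trig_poly_def w_def freq_add algebra_simps flip: exp_add)
  have cosine: "exp (- (\<i> * of_real (freq k v))) + exp (- (\<i> * of_real (freq k (- v)))) =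
      of_real (2 * cos (freq k v))" for k
    by (simp add: freq_uminus cos_exp_eq flip: cos_of_real)
  have "Re (trig_poly \<Lambda> q (\<theta> + v)) \<le>
      Re (trig_poly \<Lambda> q (\<theta> + v)) + Re (trig_poly \<Lambda> q (\<theta> + - v)) - 2 * Re (trig_poly \<Lambda> q (\<theta> + 0))"
    using nonneg[of "\<theta> + - v"] zero by simp
  also have "\<dots> = Re (\<Sum>k\<in>\<Lambda>. w k * (exp (- (\<i> * of_real (freq k v))) + exp (- (\<i> * of_real (freq k (- v)))) - 2))"
    unfolding shift by (simp add: freq_def algebra_simps sum.distrib sum_subtractf sum_distrib_left)
  also have "\<dots> \<le> norm (\<Sum>k\<in>\<Lambda>. w k * of_real (2 * cos (freq k v) - 2))"
    unfolding cosine of_real_diff of_real_numeral by (rule complex_Re_le_cmod)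
  also have "\<dots> \<le> (\<Sum>k\<in>\<Lambda>. norm (w k * of_real (2 * cos (freq k v) - 2)))"
    by (rule norm_sum)
  also have "\<dots> \<le> (\<Sum>k\<in>\<Lambda>. norm (Poly_Mapping.lookup q k) * ((\<Sum>j\<in>UNIV. \<bar>of_int (k $ j)\<bar>)\<^sup>2 * r\<^sup>2))"
  proof (rule sum_mono)
    fix k
    have "\<bar>2 * cos (freq k v) - 2\<bar> \<le> (freq k v)\<^sup>2"
      using one_minus_cos_le[of "freq k v"] by simp
    also have "\<dots> \<le> (\<Sum>j\<in>UNIV. \<bar>of_int (k $ j)\<bar>)\<^sup>2 * r\<^sup>2"
      using v by (rule freq_power2_le)
    finally have "norm (Poly_Mapping.lookup q k) * \<bar>2 * cos (freq k v) - 2\<bar> \<le>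
        norm (Poly_Mapping.lookup q k) * ((\<Sum>j\<in>UNIV. \<bar>of_int (k $ j)\<bar>)\<^sup>2 * r\<^sup>2)"
      by (rule mult_left_mono) simp
    then show "norm (w k * of_real (2 * cos (freq k v) - 2)) \<le>
        norm (Poly_Mapping.lookup q k) * ((\<Sum>j\<in>UNIV. \<bar>of_int (k $ j)\<bar>)\<^sup>2 * r\<^sup>2)"
      by (simp only: w_def norm_mult norm_of_real norm_exp_i_times norm_exp_eq_Re) simp
  qed
  finally show ?thesis by (simp add: sum_distrib_right mult.assoc)
qed

text \<open>If \<open>m\<close> is the largest index with \<open>x\<close> in \<open>B m\<close>,
  the sum is at most a geometric sum bounded by \<open>2 * 4 ^ m\<close>, and the hypothesis at
  \<open>m\<close> bounds \<open>4 ^ m\<close> by \<open>K / y\<close>.\<close>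

lemma nested_indicator_sum_le:
  fixes B :: "nat \<Rightarrow> 'a set" and y :: real
  assumes "0 < y" "0 \<le> K" "\<And>n. n < N \<Longrightarrow> x \<in> B n \<Longrightarrow> y \<le> K / 4 ^ n"
  shows "(\<Sum>n<N. 4 ^ n * indicator (B n) x) \<le> 2 * K / y"
proof (cases "{n. n < N \<and> x \<in> B n} = {}")
  case True
  then have "(\<Sum>n<N. 4 ^ n * indicator (B n) x) = (0::real)"
    by (intro sum.neutral) auto
  then show ?thesis using assms by simp
next
  case False
  define m where "m = Max {n. n < N \<and> x \<in> B n}"
  have "m \<in> {n. n < N \<and> x \<in> B n}"
    unfolding m_def using False by (intro Max_in) auto
  then have m: "m < N" "x \<in> B m" by auto
  have geometric: "(\<Sum>n\<le>i. 4 ^ n) \<le> 2 * (4::real) ^ i - 1" for i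
  proof (induction i)
    case (Suc i)
    then show ?case
      using zero_le_power[of "4::real" i] unfolding sum.atMost_Suc power_Suc by linarith
  qed simp
  have "(\<Sum>n<N. 4 ^ n * indicator (B n) x) \<le> (\<Sum>n<N. if n \<le> m then 4 ^ n else (0::real))"
  proof (rule sum_mono)
    fix n assume "n \<in> {..<N}"
    moreover have "n \<le> m" if "n < N" "x \<in> B n"
      unfolding m_def using that by (intro Max_ge) auto
    ultimately show "4 ^ n * indicator (B n) x \<le> (if n \<le> m then 4 ^ n else (0::real))"
      by (auto simp: indicator_def)
  qed
  also have "\<dots> = (\<Sum>n\<le>m. 4 ^ n)"
    using m by (intro sum.mono_neutral_cong_right) auto
  also have "\<dots> \<le> 2 * 4 ^ m" using geometric[of m] by simp
  also have "\<dots> \<le> 2 * K / y"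
    using assms(3)[OF m] assms(1) by (simp add: field_simps)
  finally show ?thesis .
qed

text \<open>Near a zero, \<open>Q\<close> is at most quadratic, so its reciprocal is not integrable in dimension
  at most two: each of the nested boxes of side \<open>2\<^sup>-\<^sup>n\<close> contributes at least a fixed amount.\<close>

lemma integral_inverse_trig_poly_unbounded:
  fixes \<Lambda> :: "(int ^ 'd::finite) set"
  assumes "CARD('d) \<le> 2"
    and nonneg: "\<And>\<theta>. 0 \<le> Re (trig_poly \<Lambda> q \<theta>)"
    and zero: "\<theta> \<in> torus" "Re (trig_poly \<Lambda> q \<theta>) = 0"
  obtains \<delta> where "0 < \<delta>" "b \<le> (LINT \<phi>|torus_measure. 1 / (Re (trig_poly \<Lambda> q \<phi>) + \<delta>))"
proof -
  define C where "C = (\<Sum>k\<in>\<Lambda>. norm (Poly_Mapping.lookup q k) * (\<Sum>j\<in>UNIV. \<bar>real_of_int (k $ j)\<bar>)\<^sup>2)"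
  have "0 \<le> C" unfolding C_def by (intro sum_nonneg mult_nonneg_nonneg) auto
  define \<kappa> :: real where "\<kappa> = (1 / (2 * pi)) ^ CARD('d)"
  have "0 < \<kappa>" by (simp add: \<kappa>_def)
  \<comment> \<open>\<open>N\<close> is the number of scales: each will contribute at least
    \<open>\<kappa>\<close> to the integral, up to the factor \<open>2 * (C + 1)\<close> from the
    pointwise bound.\<close>
  obtain N where N: "b * (2 * (C + 1)) / \<kappa> \<le> real N" using real_arch_simple by blast
  \<comment> \<open>This is at most \<open>1 / 4 ^ n\<close> for every scale \<open>n < N\<close>,
    so adding \<open>\<delta>\<close> only raises the constant of the quadratic bound from
    \<open>C\<close> to \<open>C + 1\<close>.\<close>
  define \<delta> :: real where "\<delta> = 1 / 4 ^ N"
  have "0 < \<delta>" by (simp add: \<delta>_def)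
  define B where "B n = corner_box \<theta> (1 / 2 ^ n)" for n :: nat
  interpret finite_measure "torus_measure :: (real ^ 'd) measure"
    by (rule finite_measure_torus)
  have integrable_B [simp]: "integrable torus_measure (indicator (B n) :: _ \<Rightarrow> real)" for n
    by (rule integrable_real_indicator) (auto simp: B_def less_top[symmetric])
  have pointwise: "(\<Sum>n<N. 4 ^ n * indicator (B n) \<phi>) \<le> 2 * (C + 1) / (Re (trig_poly \<Lambda> q \<phi>) + \<delta>)" for \<phi>
  proof (rule nested_indicator_sum_le)
    fix n assume n: "n < N" "\<phi> \<in> B n"
    have "Re (trig_poly \<Lambda> q (\<theta> + (\<phi> - \<theta>))) \<le> C * (1 / 2 ^ n)\<^sup>2"
      unfolding C_def using n(2)
      by (intro trig_poly_quadratic_at_zero nonneg zero corner_box_coordinate) (simp add: B_def)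
    also have "(1 / 2 ^ n)\<^sup>2 = 1 / (4::real) ^ n"
      by (simp add: power_divide power2_eq_square flip: power_mult_distrib)
    finally have "Re (trig_poly \<Lambda> q \<phi>) \<le> C / 4 ^ n" by simp
    moreover have "\<delta> \<le> 1 / 4 ^ n"
      using n(1) by (simp add: \<delta>_def frac_le)
    ultimately show "Re (trig_poly \<Lambda> q \<phi>) + \<delta> \<le> (C + 1) / 4 ^ n"
      by (simp add: add_divide_distrib)
  qed (use nonneg[of \<phi>] \<open>0 < \<delta>\<close> \<open>0 \<le> C\<close> in auto)
  have "real N * \<kappa> \<le> (\<Sum>n<N. 4 ^ n * measure torus_measure (B n))"
  proof -
    \<comment> \<open>The dimension bound enters here: the weight \<open>4 ^ n\<close> compensates
      the volume of a box of side \<open>1 / 2 ^ n\<close> when there are at most two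
      coordinates.\<close>
    have "\<kappa> \<le> 4 ^ n * measure torus_measure (B n)" for n
    proof -
      have "(1 / 2 ^ n) ^ 2 \<le> (1 / (2::real) ^ n) ^ CARD('d)"
        using assms(1) by (intro power_decreasing) auto
      moreover have "(1 / 2 ^ n)\<^sup>2 = 1 / (4::real) ^ n"
        by (simp add: power_divide power2_eq_square flip: power_mult_distrib)
      ultimately have "1 \<le> 4 ^ n * (1 / (2::real) ^ n) ^ CARD('d)"
        by (simp add: field_simps)
      then have "\<kappa> * 1 \<le> \<kappa> * (4 ^ n * (1 / (2::real) ^ n) ^ CARD('d))"
        using \<open>0 < \<kappa>\<close> by (intro mult_left_mono) auto
      then show ?thesis
        unfolding B_def using zero(1) by (subst measure_corner_box) (auto simp: \<kappa>_def mult_ac)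
    qed
    then have "(\<Sum>n<N. \<kappa>) \<le> (\<Sum>n<N. 4 ^ n * measure torus_measure (B n))"
      by (intro sum_mono) auto
    then show ?thesis by simp
  qed
  also have "\<dots> = (LINT \<phi>|torus_measure. (\<Sum>n<N. 4 ^ n * indicator (B n) \<phi>))"
    by (subst Bochner_Integration.integral_sum) (auto simp: integrable_B)
  also have "\<dots> \<le> (LINT \<phi>|torus_measure. 2 * (C + 1) / (Re (trig_poly \<Lambda> q \<phi>) + \<delta>))"
  proof (rule integral_mono)
    have "Re (trig_poly \<Lambda> q \<phi>) + \<delta> \<noteq> 0" for \<phi>
      using nonneg[of \<phi>] \<open>0 < \<delta>\<close> by linarith
    then show "integrable torus_measure (\<lambda>\<phi>. 2 * (C + 1) / (Re (trig_poly \<Lambda> q \<phi>) + \<delta>))"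
      by (intro integrable_torus continuous_intros continuous_on_trig_poly) auto
    show "integrable torus_measure (\<lambda>\<phi>. \<Sum>n<N. 4 ^ n * indicator (B n) \<phi> :: real)"
      by (intro Bochner_Integration.integrable_sum integrable_mult_right integrable_B)
  qed (rule pointwise)
  also have "\<dots> = 2 * (C + 1) * (LINT \<phi>|torus_measure. 1 / (Re (trig_poly \<Lambda> q \<phi>) + \<delta>))"
    by (subst integral_mult_right_zero[symmetric]) simp
  finally have "b * (2 * (C + 1)) \<le> 2 * (C + 1) * (LINT \<phi>|torus_measure. 1 / (Re (trig_poly \<Lambda> q \<phi>) + \<delta>))"
    using N \<open>0 < \<kappa>\<close> by (simp add: field_simps)
  then have "b \<le> (LINT \<phi>|torus_measure. 1 / (Re (trig_poly \<Lambda> q \<phi>) + \<delta>))"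
    using \<open>0 \<le> C\<close> by (simp add: mult.commute)
  with \<open>0 < \<delta>\<close> show ?thesis by (rule that)
qed

section \<open>The moment problem for fixed data\<close>

locale trigonometric_moment_problem =
  fixes \<Lambda> :: "(int ^ 'd::finite) set" and c p :: "(int ^ 'd) \<Rightarrow>\<^sub>0 complex"
  assumes finite_index: "finite \<Lambda>" and zero_index: "0 \<in> \<Lambda>" and symmetric_index: "uminus ` \<Lambda> = \<Lambda>"
    and c: "c \<in> dual_cone \<Lambda>" and p: "p \<in> pos_polys \<Lambda>"
begin

abbreviation T :: "((int ^ 'd) \<Rightarrow>\<^sub>0 complex) \<Rightarrow> real ^ 'd \<Rightarrow> real" where
  "T q \<theta> \<equiv> Re (trig_poly \<Lambda> q \<theta>)"

abbreviation J :: "((int ^ 'd) \<Rightarrow>\<^sub>0 complex) \<Rightarrow> real" where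
  "J \<equiv> dual_functional \<Lambda> c p"

text \<open>The derivative of \<open>J\<close> at \<open>q\<close> in the direction \<open>h\<close>.\<close>

definition dJ :: "((int ^ 'd) \<Rightarrow>\<^sub>0 complex) \<Rightarrow> ((int ^ 'd) \<Rightarrow>\<^sub>0 complex) \<Rightarrow> real" where
  "dJ q h = Re (pairing \<Lambda> c h) - (LINT \<theta>|torus_measure. T p \<theta> * T h \<theta> / T q \<theta>)"

lemma uminus_index: "k \<in> \<Lambda> \<Longrightarrow> - k \<in> \<Lambda>"
  using symmetric_index by auto

lemma hermitian_add: "x \<in> hermitian_coeffs \<Lambda> \<Longrightarrow> y \<in> hermitian_coeffs \<Lambda> \<Longrightarrow> x + y \<in> hermitian_coeffs \<Lambda>"
  using keys_add[of x y] by (auto simp: hermitian_coeffs_def lookup_add)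

lemma hermitian_diff: "x \<in> hermitian_coeffs \<Lambda> \<Longrightarrow> y \<in> hermitian_coeffs \<Lambda> \<Longrightarrow> x - y \<in> hermitian_coeffs \<Lambda>"
  using keys_diff[of x y] by (auto simp: hermitian_coeffs_def lookup_minus)

lemma hermitian_scaleR: "x \<in> hermitian_coeffs \<Lambda> \<Longrightarrow> r *\<^sub>R x \<in> hermitian_coeffs \<Lambda>"
  by (auto simp: hermitian_coeffs_def lookup_scaleR in_keys_iff subset_iff)

lemma pos_hermitian: "x \<in> pos_polys \<Lambda> \<Longrightarrow> x \<in> hermitian_coeffs \<Lambda>"
  by (simp add: pos_polys_def)

lemma T_pos: "x \<in> pos_polys \<Lambda> \<Longrightarrow> 0 < T x \<theta>"
  by (rule trig_poly_pos_everywhere)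

lemma T_nonzero: "x \<in> pos_polys \<Lambda> \<Longrightarrow> T x \<theta> \<noteq> 0"
  using T_pos[of x \<theta>] by simp

lemma abs_T_le: "x \<in> hermitian_coeffs \<Lambda> \<Longrightarrow> \<bar>T x \<theta>\<bar> \<le> norm x"
  using abs_Re_le_cmod[of "trig_poly \<Lambda> x \<theta>"] norm_trig_poly_le[OF finite_index, of x \<theta>]
  by (auto simp: hermitian_coeffs_def)

lemma convex_pos_polys: "convex (pos_polys \<Lambda>)"
  unfolding convex_def
proof (intro ballI allI impI)
  fix x y :: "(int ^ 'd) \<Rightarrow>\<^sub>0 complex" and u v :: real
  assume xy: "x \<in> pos_polys \<Lambda>" "y \<in> pos_polys \<Lambda>" and uv: "0 \<le> u" "0 \<le> v" "u + v = 1"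
  have "0 < u * T x \<theta> + v * T y \<theta>" for \<theta>
    using T_pos[OF xy(1), of \<theta>] T_pos[OF xy(2), of \<theta>] uv
    by (cases "u = 0") (auto simp: add_pos_nonneg)
  then show "u *\<^sub>R x + v *\<^sub>R y \<in> pos_polys \<Lambda>"
    using xy by (simp add: pos_polys_def hermitian_add hermitian_scaleR trig_poly_add trig_poly_scaleR)
qed

lemma trig_poly_single: "k \<in> \<Lambda> \<Longrightarrow> trig_poly \<Lambda> (Poly_Mapping.single k a) \<theta> = a * exp (- (\<i> * of_real (freq k \<theta>)))"
  using finite_index by (simp add: trig_poly_def lookup_single when_def if_distrib[where f = "\<lambda>x. x * _"] cong: if_cong)

lemma pairing_single: "k \<in> \<Lambda> \<Longrightarrow> pairing \<Lambda> c (Poly_Mapping.single k a) = Poly_Mapping.lookup c k * cnj a"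
  using finite_index by (simp add: pairing_def lookup_single when_def if_distrib[where f = cnj] if_distrib[where f = "\<lambda>x. _ * x"] cong: if_cong)

lemma hermitian_single_0: "Poly_Mapping.single 0 (of_real a) \<in> hermitian_coeffs \<Lambda>"
  using zero_index by (auto simp: hermitian_coeffs_def lookup_single when_def in_keys_iff split: if_splits)

lemma T_single_0: "T (Poly_Mapping.single 0 (of_real a)) \<theta> = a"
  using zero_index by (simp add: trig_poly_single freq_def)

lemma pos_single_0: "0 < a \<Longrightarrow> Poly_Mapping.single 0 (of_real a) \<in> pos_polys \<Lambda>"
  using hermitian_single_0[of a] T_single_0[of a] by (simp add: pos_polys_def)

text \<open>Independence of the characters gives a point where the difference is nonzero,
  periodicity moves it into \<open>torus\<close>, and since the difference is real-valued its real
  part is nonzero there.\<close>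

lemma hermitian_T_neq:
  assumes "x \<in> hermitian_coeffs \<Lambda>" "y \<in> hermitian_coeffs \<Lambda>" "x \<noteq> y"
  obtains \<theta> where "\<theta> \<in> torus" "T x \<theta> \<noteq> T y \<theta>"
proof -
  have h: "x - y \<in> hermitian_coeffs \<Lambda>" using assms(1,2) by (rule hermitian_diff)
  have "\<exists>\<theta>. trig_poly \<Lambda> (x - y) \<theta> \<noteq> 0"
    using trig_poly_eq_0_imp[OF finite_index, of "x - y"] h assms(3) by (auto simp: hermitian_coeffs_def)
  then obtain \<theta> where \<theta>: "\<theta> \<in> torus" "trig_poly \<Lambda> (x - y) \<theta> \<noteq> 0"
    by (metis torus_representative)
  moreover have "trig_poly \<Lambda> (x - y) \<theta> \<in> \<real>"
    using symmetric_index h by (rule trig_poly_real)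
  ultimately have "T (x - y) \<theta> \<noteq> 0"
    by (metis of_real_0 of_real_Re)
  then show ?thesis using that[OF \<theta>(1)] by (simp add: trig_poly_diff)
qed

section \<open>The derivative, the gradient inequality and strict convexity\<close>

lemma integrable_quotient: "q \<in> pos_polys \<Lambda> \<Longrightarrow> integrable torus_measure (\<lambda>\<theta>. T p \<theta> * T h \<theta> / T q \<theta>)"
  by (intro integrable_torus continuous_intros continuous_on_trig_poly ballI T_nonzero)

lemma integrable_T_ln: "q \<in> pos_polys \<Lambda> \<Longrightarrow> integrable torus_measure (\<lambda>\<theta>. T p \<theta> * ln (T q \<theta>))"
  by (intro integrable_torus continuous_intros continuous_on_trig_poly ballI T_nonzero)

lemma dJ_add: "q \<in> pos_polys \<Lambda> \<Longrightarrow> dJ q (x + y) = dJ q x + dJ q y"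
  using Bochner_Integration.integral_add[OF integrable_quotient integrable_quotient, of q q x y]
  by (simp add: dJ_def pairing_add trig_poly_add ring_distribs add_divide_distrib)

lemma dJ_scaleR: "dJ q (r *\<^sub>R x) = r * dJ q x"
  using integral_mult_right_zero[of torus_measure r "\<lambda>\<theta>. T p \<theta> * T x \<theta> / T q \<theta>"]
  by (simp add: dJ_def pairing_scaleR trig_poly_scaleR algebra_simps)

lemma dJ_zero [simp]: "dJ q 0 = 0"
  using dJ_scaleR[of q 0 0] by simp

text \<open>The pointwise inequality \<open>ln x \<le> x - 1\<close> at \<open>x = R / Q\<close>, weighted by \<open>P\<close>.\<close>

lemma dual_functional_gradient_less:
  assumes q: "q \<in> pos_polys \<Lambda>" and r: "r \<in> pos_polys \<Lambda>" and "q \<noteq> r"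
  shows "J q - J r < dJ q (q - r)"
proof -
  \<comment> \<open>The pairing is linear and cancels, so the integral of \<open>f\<close> is
    \<open>dJ q (q - r) - (J q - J r)\<close>.\<close>
  define f where "f \<theta> = T p \<theta> * ln (T q \<theta>) - T p \<theta> * ln (T r \<theta>) - T p \<theta> * T (q - r) \<theta> / T q \<theta>" for \<theta>
  have f_eq: "f \<theta> = T p \<theta> * (T r \<theta> / T q \<theta> - 1 - ln (T r \<theta> / T q \<theta>))" for \<theta>
    using T_pos[OF q, of \<theta>] T_pos[OF r, of \<theta>]
    by (simp add: f_def ln_div trig_poly_diff field_simps)
  have "0 \<le> f \<theta>" for \<theta>
    unfolding f_eq using T_pos[OF q, of \<theta>] T_pos[OF r, of \<theta>] T_pos[OF p, of \<theta>]
      ln_le_minus_one[of "T r \<theta> / T q \<theta>"] by simp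
  moreover obtain \<theta> where \<theta>: "\<theta> \<in> torus" "T q \<theta> \<noteq> T r \<theta>"
    using hermitian_T_neq[OF pos_hermitian[OF q] pos_hermitian[OF r] \<open>q \<noteq> r\<close>] .
  moreover have "0 < f \<theta>"
  proof -
    have x: "0 < T r \<theta> / T q \<theta>" "T r \<theta> / T q \<theta> \<noteq> 1"
      using T_pos[OF q, of \<theta>] T_pos[OF r, of \<theta>] \<theta>(2) by auto
    then have "ln (T r \<theta> / T q \<theta>) < T r \<theta> / T q \<theta> - 1"
      using ln_le_minus_one[OF x(1)] ln_eq_minus_one[OF x(1)] by linarith
    then show ?thesis unfolding f_eq using T_pos[OF p, of \<theta>] by simp
  qed
  moreover have "continuous_on UNIV f"
    unfolding f_def
    by (intro continuous_intros continuous_on_trig_poly ballI T_nonzero q r)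
  ultimately have "0 < integral\<^sup>L torus_measure f"
    by (intro integral_torus_pos)
  also have "integral\<^sup>L torus_measure f = (LINT \<theta>|torus_measure. T p \<theta> * ln (T q \<theta>)) -
      (LINT \<theta>|torus_measure. T p \<theta> * ln (T r \<theta>)) - (LINT \<theta>|torus_measure. T p \<theta> * T (q - r) \<theta> / T q \<theta>)"
    unfolding f_def
    by (simp only: Bochner_Integration.integral_diff Bochner_Integration.integrable_diff
        integrable_T_ln integrable_quotient q r)
  finally show ?thesis by (simp add: dual_functional_def dJ_def pairing_diff)
qed

lemma dual_functional_gradient_le:
  "q \<in> pos_polys \<Lambda> \<Longrightarrow> r \<in> pos_polys \<Lambda> \<Longrightarrow> J q - J r \<le> dJ q (q - r)"
  using dual_functional_gradient_less[of q r] by (cases "q = r") auto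

text \<open>The gradient inequality is applied at the convex combination \<open>z\<close> against
  both end points. With weights \<open>u\<close> and \<open>v\<close> the directions
  \<open>z - x\<close> and \<open>z - y\<close> add up to zero, so the derivative terms
  cancel.\<close>

lemma strictly_convex_dual_functional: "strictly_convex_on (pos_polys \<Lambda>) J"
  unfolding strictly_convex_on_def
proof (intro conjI convex_pos_polys ballI allI impI)
  fix x y :: "(int ^ 'd) \<Rightarrow>\<^sub>0 complex" and u v :: real
  assume xy: "x \<in> pos_polys \<Lambda>" "y \<in> pos_polys \<Lambda>" "x \<noteq> y" and uv: "0 < u" "0 < v" "u + v = 1"
  define z where "z = u *\<^sub>R x + v *\<^sub>R y"
  have z: "z \<in> pos_polys \<Lambda>"
    unfolding z_def using convex_pos_polys xy uv by (simp add: convex_def)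
  have u: "u = 1 - v" using uv by simp
  have zx: "z - x = v *\<^sub>R (y - x)" and zy: "z - y = u *\<^sub>R (x - y)"
    unfolding z_def u by (simp_all add: algebra_simps)
  have "z \<noteq> x" "z \<noteq> y" using zx zy xy(3) uv by auto
  then have "u * (J z - J x) + v * (J z - J y) < u * dJ z (z - x) + v * dJ z (z - y)"
    using z xy uv dual_functional_gradient_less by (intro add_strict_mono mult_strict_left_mono) auto
  also have "\<dots> = dJ z (u *\<^sub>R (z - x) + v *\<^sub>R (z - y))"
    using z by (simp add: dJ_add dJ_scaleR)
  also have "u *\<^sub>R (z - x) + v *\<^sub>R (z - y) = 0"
    unfolding zx zy by (simp add: algebra_simps)
  finally have "(u + v) * J z < u * J x + v * J y" by (simp add: algebra_simps)
  then show "J (u *\<^sub>R x + v *\<^sub>R y) < u * J x + v * J y"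
    using uv by (simp add: z_def)
qed

section \<open>Coercivity\<close>

text \<open>The nonnegative polynomials of norm 1 form a compact set, on which the pairing attains a
  minimum; it is positive because \<open>c\<close> lies in the dual cone. Homogeneity extends the
  bound to the closed cone.\<close>

lemma pairing_coercive:
  obtains \<epsilon> where "0 < \<epsilon>" "\<And>q. q \<in> closure (pos_polys \<Lambda>) \<Longrightarrow> \<epsilon> * norm q \<le> Re (pairing \<Lambda> c q)"
proof -
  note closure = closure_pos_polys[OF finite_index zero_index]
  let ?S = "closure (pos_polys \<Lambda>) \<inter> {q. norm q = 1}"
  let ?K = "{q :: (int ^ 'd) \<Rightarrow>\<^sub>0 complex. Poly_Mapping.keys q \<subseteq> \<Lambda> \<and> (\<forall>k. norm (Poly_Mapping.lookup q k) \<le> 1)}"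
  have "?S \<subseteq> ?K"
  proof
    fix q assume q: "q \<in> ?S"
    have "norm (Poly_Mapping.lookup q k) \<le> 1" for k
      using norm_lookup_le[of q k] q by simp
    then show "q \<in> ?K" using q unfolding closure by (simp add: hermitian_coeffs_def)
  qed
  then have "?S = ?K \<inter> (closure (pos_polys \<Lambda>) \<inter> {q. norm q = 1})" by auto
  moreover have "compact \<dots>"
    using finite_index
    by (intro compact_Int_closed compact_bounded_poly_mapping closed_Int closed_closure
        closed_Collect_eq continuous_intros)
  ultimately have "compact ?S" by simp
  moreover have "Poly_Mapping.single 0 1 \<in> ?S"
    using pos_single_0[of 1] closure_subset
    by (auto simp: norm_poly_mapping_def dist_poly_mapping_def simp del: single_one)
  moreover have "continuous_on ?S (\<lambda>q. Re (pairing \<Lambda> c q))"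
    by (intro continuous_intros continuous_on_pairing)
  ultimately obtain x where x: "x \<in> ?S" "\<And>q. q \<in> ?S \<Longrightarrow> Re (pairing \<Lambda> c x) \<le> Re (pairing \<Lambda> c q)"
    using continuous_attains_inf[of ?S "\<lambda>q. Re (pairing \<Lambda> c q)"] by blast
  have "x \<noteq> 0" using x(1) by auto
  then have "0 < Re (pairing \<Lambda> c x)"
    using c x(1) by (auto simp: dual_cone_def)
  moreover have "Re (pairing \<Lambda> c x) * norm q \<le> Re (pairing \<Lambda> c q)" if q: "q \<in> closure (pos_polys \<Lambda>)" for q
  proof (cases "q = 0")
    case True
    then show ?thesis by (simp add: pairing_def)
  next
    case False
    have "inverse (norm q) *\<^sub>R q \<in> ?S"
      using q False unfolding closure by (auto simp: hermitian_scaleR trig_poly_scaleR)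
    from x(2)[OF this] show ?thesis using False by (simp add: pairing_scaleR field_simps)
  qed
  ultimately show ?thesis by (rule that)
qed

lemma integral_T_p_nonneg: "0 \<le> integral\<^sup>L torus_measure (T p)"
  using T_pos[OF p] by (intro Bochner_Integration.integral_nonneg) (simp add: less_imp_le)

lemma integrable_T: "integrable torus_measure (T q)"
  by (intro integrable_torus continuous_intros continuous_on_trig_poly)

text \<open>Since \<open>T q\<close> is at most \<open>norm q\<close>, the integral term grows at
  most logarithmically in the norm and is absorbed by half of the linear growth of the
  pairing.\<close>

lemma dual_functional_coercive:
  obtains \<epsilon> b where "0 < \<epsilon>" "\<And>q. q \<in> pos_polys \<Lambda> \<Longrightarrow> \<epsilon> * norm q + b \<le> J q"
proof -
  obtain \<epsilon> where \<epsilon>: "0 < \<epsilon>" "\<And>q. q \<in> closure (pos_polys \<Lambda>) \<Longrightarrow> \<epsilon> * norm q \<le> Re (pairing \<Lambda> c q)"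
    using pairing_coercive by blast
  define I where "I = integral\<^sup>L torus_measure (T p)"
  have "0 \<le> I" unfolding I_def by (rule integral_T_p_nonneg)
  \<comment> \<open>Small enough that \<open>I * a \<le> \<epsilon> / 2\<close>; the summand 1 keeps
    the denominator positive, as \<open>I\<close> is only known to be nonnegative. Below,
    \<open>ln x \<le> x - 1\<close> is used at \<open>x = a * norm q\<close>.\<close>
  define a where "a = \<epsilon> / (2 * (I + 1))"
  have a: "0 < a" "I * a \<le> \<epsilon> / 2"
    using \<epsilon>(1) \<open>0 \<le> I\<close> by (auto simp: a_def field_simps)
  have lower: "\<epsilon> / 2 * norm q + I * (1 + ln a) \<le> J q" if q: "q \<in> pos_polys \<Lambda>" for q
  proof -
    have "0 < norm q"
      using T_pos[OF q, of 0] abs_T_le[OF pos_hermitian[OF q], of 0] by linarith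
    have "ln (T q \<theta>) \<le> ln (norm q)" for \<theta>
      using T_pos[OF q, of \<theta>] abs_le_D1[OF abs_T_le[OF pos_hermitian[OF q], of \<theta>]] \<open>0 < norm q\<close>
      by (simp only: ln_le_cancel_iff)
    then have "(LINT \<theta>|torus_measure. T p \<theta> * ln (T q \<theta>)) \<le> (LINT \<theta>|torus_measure. T p \<theta> * ln (norm q))"
      using T_pos[OF p] q
      by (intro integral_mono integrable_T_ln integrable_mult_left integrable_T mult_left_mono) (auto simp: less_imp_le)
    also have "\<dots> = I * ln (norm q)" by (simp add: I_def)
    also have "\<dots> \<le> I * (a * norm q - 1 - ln a)"
      using ln_le_minus_one[of "a * norm q"] a(1) \<open>0 < norm q\<close> \<open>0 \<le> I\<close>
      by (intro mult_left_mono) (auto simp: ln_mult)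
    also have "\<dots> \<le> \<epsilon> / 2 * norm q - I * (1 + ln a)"
      using mult_right_mono[OF a(2), of "norm q"] by (simp add: algebra_simps)
    finally show ?thesis
      using \<epsilon>(2)[of q] q closure_subset by (force simp: dual_functional_def)
  qed
  show ?thesis by (rule that[OF half_gt_zero[OF \<epsilon>(1)] lower])
qed

section \<open>Existence of a minimizer\<close>

text \<open>If the limit had a zero, moving a late \<open>x n\<close> by the constant polynomial
  \<open>\<delta>\<close> would change \<open>J\<close> by at most \<open>dJ (x n + e) e\<close>.
  There the pairing contributes \<open>\<delta> * c0\<close>, but the large reciprocal integral
  outweighs it and lowers \<open>J\<close> by at least \<open>\<delta>\<close>, below
  \<open>L\<close>.\<close>

lemma minimizing_limit_pos:
  assumes dim: "CARD('d) \<le> 2"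
    and x: "\<And>n. x n \<in> pos_polys \<Lambda>" "x \<longlonglongrightarrow> q"
    and J: "(\<lambda>n. J (x n)) \<longlonglongrightarrow> L" and L: "\<And>r. r \<in> pos_polys \<Lambda> \<Longrightarrow> L \<le> J r"
  shows "q \<in> pos_polys \<Lambda>"
proof (rule ccontr)
  assume not_pos: "q \<notin> pos_polys \<Lambda>"
  have "q \<in> closure (pos_polys \<Lambda>)" using x by (auto simp: closure_sequential)
  then have q: "q \<in> hermitian_coeffs \<Lambda>" "\<And>\<theta>. \<theta> \<in> torus \<Longrightarrow> 0 \<le> T q \<theta>"
    using closure_pos_polys[OF finite_index zero_index] by auto
  obtain \<theta> where \<theta>: "\<theta> \<in> torus" "T q \<theta> = 0"
    using not_pos q by (force simp: pos_polys_def)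
  have nonneg: "0 \<le> T q \<phi>" for \<phi>
    using q(2) torus_representative[of \<phi>] by metis
  obtain m where m: "0 < m" "\<And>\<phi>. m \<le> T p \<phi>"
    using pos_polys_lower_bound[OF p] by blast
  define c0 where "c0 = Re (Poly_Mapping.lookup c 0)"
  \<comment> \<open>Since \<open>T p\<close> is at least \<open>m\<close>, this size makes the
    integral term exceed the pairing term by \<open>\<delta>\<close>.\<close>
  obtain \<delta>' where \<delta>': "0 < \<delta>'" "(c0 + 1) / m \<le> (LINT \<phi>|torus_measure. 1 / (T q \<phi> + \<delta>'))"
    using integral_inverse_trig_poly_unbounded[OF dim nonneg \<theta>] by blast
  \<comment> \<open>One half of \<open>\<delta>'\<close> pays for the distance of \<open>x n\<close>
    from \<open>q\<close>, the other for the added constant, so \<open>T (x n + e)\<close> stays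
    below \<open>T q + \<delta>'\<close>. The same \<open>\<delta>\<close> is the tolerance for
    \<open>J (x n)\<close>, to be beaten by the decrease.\<close>
  define \<delta> where "\<delta> = \<delta>' / 2"
  have "0 < \<delta>" using \<delta>' by (simp add: \<delta>_def)
  have "\<forall>\<^sub>F n in sequentially. dist (x n) q < \<delta> \<and> J (x n) < L + \<delta>"
    using tendstoD[OF x(2) \<open>0 < \<delta>\<close>] order_tendstoD(2)[OF J, of "L + \<delta>"] \<open>0 < \<delta>\<close>
    by (auto intro: eventually_conj)
  then obtain n where n: "dist (x n) q < \<delta>" "J (x n) < L + \<delta>"
    by (auto dest: eventually_happens)
  define e :: "(int ^ 'd) \<Rightarrow>\<^sub>0 complex" where "e = Poly_Mapping.single 0 (of_real \<delta>)"
  have Te: "T e \<phi> = \<delta>" for \<phi> by (simp add: e_def T_single_0)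
  have y: "x n + e \<in> pos_polys \<Lambda>"
    using T_pos[OF x(1)[of n]] \<open>0 < \<delta>\<close> pos_hermitian[OF x(1)[of n]] Te
    by (simp add: pos_polys_def hermitian_add hermitian_single_0[folded e_def] e_def trig_poly_add add_pos_pos)
  have "(c0 + 1) / m * (\<delta> * m) \<le> \<delta> * m * (LINT \<phi>|torus_measure. 1 / (T q \<phi> + \<delta>'))"
    using mult_right_mono[OF \<delta>'(2), of "\<delta> * m"] \<open>0 < \<delta>\<close> m(1) by (simp add: mult.commute)
  also have "\<dots> = (LINT \<phi>|torus_measure. m * \<delta> / (T q \<phi> + \<delta>'))"
    by (subst integral_mult_right_zero[symmetric]) (simp add: mult.commute)
  also have "\<dots> \<le> (LINT \<phi>|torus_measure. T p \<phi> * T e \<phi> / T (x n + e) \<phi>)"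
  proof (intro integral_mono integrable_quotient y)
    have "T q \<phi> + \<delta>' \<noteq> 0" for \<phi> using nonneg[of \<phi>] \<delta>'(1) by linarith
    then show "integrable torus_measure (\<lambda>\<phi>. m * \<delta> / (T q \<phi> + \<delta>'))"
      by (intro integrable_torus continuous_intros continuous_on_trig_poly) auto
    fix \<phi>
    have "T (x n - q) \<phi> \<le> \<delta>"
      using abs_T_le[OF hermitian_diff[OF pos_hermitian[OF x(1)] q(1)], of n \<phi>] n(1)
      by (simp add: dist_norm)
    then have "T (x n + e) \<phi> \<le> T q \<phi> + \<delta>'"
      using Te[of \<phi>] by (simp add: trig_poly_add trig_poly_diff \<delta>_def)
    then show "m * \<delta> / (T q \<phi> + \<delta>') \<le> T p \<phi> * T e \<phi> / T (x n + e) \<phi>"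
      unfolding Te using m T_pos[OF y, of \<phi>] T_pos[OF p, of \<phi>] \<open>0 < \<delta>\<close>
      by (intro frac_le mult_right_mono) (auto intro: order_trans less_imp_le)
  qed
  also have "(c0 + 1) / m * (\<delta> * m) = \<delta> * (c0 + 1)"
    using m(1) by simp
  finally have "\<delta> * (c0 + 1) \<le> (LINT \<phi>|torus_measure. T p \<phi> * T e \<phi> / T (x n + e) \<phi>)" .
  moreover have "Re (pairing \<Lambda> c e) = \<delta> * c0"
    using zero_index by (simp add: e_def pairing_single c0_def)
  ultimately have "dJ (x n + e) e \<le> - \<delta>"
    by (simp add: dJ_def algebra_simps)
  then have "J (x n + e) - J (x n) \<le> - \<delta>"
    using dual_functional_gradient_le[OF y x(1)[of n]] by simp
  then show False using L[OF y] n(2) by simp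
qed

text \<open>Coercivity confines a minimizing sequence to a compact set, and its limit point is
  positive by the preceding lemma. Instead of continuity of \<open>J\<close>, the gradient
  inequality at the limit \<open>q\<close> bounds \<open>J q\<close> by \<open>J\<close> along the
  sequence plus terms that tend to zero.\<close>

lemma dual_functional_attains_inf:
  assumes dim: "CARD('d) \<le> 2"
  obtains q where "q \<in> pos_polys \<Lambda>" "\<And>r. r \<in> pos_polys \<Lambda> \<Longrightarrow> J q \<le> J r"
proof -
  obtain \<epsilon> b where \<epsilon>: "0 < \<epsilon>" and b: "\<And>q. q \<in> pos_polys \<Lambda> \<Longrightarrow> \<epsilon> * norm q + b \<le> J q"
    using dual_functional_coercive by blast
  have bdd: "bdd_below (J ` pos_polys \<Lambda>)"
  proof (rule bdd_belowI2)
    fix q assume "q \<in> pos_polys \<Lambda>"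
    moreover have "0 \<le> \<epsilon> * norm q" using \<epsilon> by simp
    ultimately show "b \<le> J q" using b[of q] by linarith
  qed
  define L where "L = Inf (J ` pos_polys \<Lambda>)"
  have L: "L \<le> J r" if "r \<in> pos_polys \<Lambda>" for r
    unfolding L_def using that by (intro cInf_lower bdd) auto
  have "\<exists>q\<in>pos_polys \<Lambda>. J q < L + inverse (Suc n)" for n
    using cInf_lessD[of "J ` pos_polys \<Lambda>" "L + inverse (Suc n)"] p by (auto simp: L_def simp del: of_nat_Suc)
  then obtain x where x: "\<And>n. x n \<in> pos_polys \<Lambda>" "\<And>n. J (x n) < L + inverse (Suc n)"
    by metis
  \<comment> \<open>Coercivity solved for the norm, given \<open>J (x n) < L + 1\<close>.\<close>
  define R where "R = (L + 1 - b) / \<epsilon>"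
  have norm_x: "norm (x n) \<le> R" for n
  proof -
    have "inverse (real (Suc n)) \<le> 1" by (simp add: field_simps)
    then have "\<epsilon> * norm (x n) \<le> L + 1 - b" using b[OF x(1)[of n]] x(2)[of n] by linarith
    then show ?thesis using \<epsilon> by (simp add: R_def field_simps)
  qed
  have "norm (Poly_Mapping.lookup (x n) k) \<le> R" for n k
    by (rule order_trans[OF norm_lookup_le norm_x])
  then have "\<forall>n. x n \<in> {q. Poly_Mapping.keys q \<subseteq> \<Lambda> \<and> (\<forall>k. norm (Poly_Mapping.lookup q k) \<le> R)}"
    using pos_hermitian[OF x(1)] by (simp add: hermitian_coeffs_def)
  then obtain q s where s: "strict_mono (s :: nat \<Rightarrow> nat)" and q: "(x \<circ> s) \<longlonglongrightarrow> q"
    using compact_bounded_poly_mapping[OF finite_index, where R = R and 'b = complex]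
    unfolding compact_def by blast
  have "(\<lambda>n. J (x n)) \<longlonglongrightarrow> L"
  proof (rule tendsto_sandwich[OF _ _ tendsto_const])
    show "\<forall>\<^sub>F n in sequentially. L \<le> J (x n)" by (simp add: L x(1))
    show "\<forall>\<^sub>F n in sequentially. J (x n) \<le> L + inverse (real (Suc n))"
      by (intro always_eventually allI less_imp_le x(2))
    show "(\<lambda>n. L + inverse (real (Suc n))) \<longlonglongrightarrow> L"
      using tendsto_add[OF tendsto_const LIMSEQ_inverse_real_of_nat, of L] by simp
  qed
  then have J: "(\<lambda>n. J ((x \<circ> s) n)) \<longlonglongrightarrow> L"
    using LIMSEQ_subseq_LIMSEQ[OF _ s] by (fastforce simp: o_def)
  have pos: "q \<in> pos_polys \<Lambda>"
    by (rule minimizing_limit_pos[OF dim _ q J L]) (simp_all add: x)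
  define I where "I = (LINT \<theta>|torus_measure. T p \<theta> / T q \<theta>)"
  have upper: "J q \<le> J ((x \<circ> s) n) + Re (pairing \<Lambda> c (q - (x \<circ> s) n)) + norm (q - (x \<circ> s) n) * I" for n
  proof -
    define h where "h = q - (x \<circ> s) n"
    have "- (norm h * I) = (LINT \<theta>|torus_measure. - norm h * (T p \<theta> / T q \<theta>))"
      unfolding I_def by (subst integral_mult_right_zero) simp
    also have "\<dots> \<le> (LINT \<theta>|torus_measure. T p \<theta> * T h \<theta> / T q \<theta>)"
    proof (intro integral_mono integrable_quotient pos)
      show "integrable torus_measure (\<lambda>\<theta>. - norm h * (T p \<theta> / T q \<theta>))"
        by (intro integrable_torus continuous_intros continuous_on_trig_poly ballI T_nonzero pos)
      fix \<theta>
      have "h \<in> hermitian_coeffs \<Lambda>"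
        unfolding h_def by (intro hermitian_diff pos_hermitian pos) (simp add: x)
      then have "- norm h \<le> T h \<theta>" using abs_T_le[of h \<theta>] by linarith
      then have "- norm h * (T p \<theta> / T q \<theta>) \<le> T h \<theta> * (T p \<theta> / T q \<theta>)"
        using T_pos[OF p, of \<theta>] T_pos[OF pos, of \<theta>] by (intro mult_right_mono) auto
      then show "- norm h * (T p \<theta> / T q \<theta>) \<le> T p \<theta> * T h \<theta> / T q \<theta>" by (simp add: mult.commute)
    qed
    finally show ?thesis
      using dual_functional_gradient_le[OF pos, of "(x \<circ> s) n"] x(1) by (simp add: dJ_def h_def)
  qed
  have diff: "(\<lambda>n. q - (x \<circ> s) n) \<longlonglongrightarrow> 0"
    using tendsto_diff[OF tendsto_const q, of q] by simp
  have "(\<lambda>n. pairing \<Lambda> c (q - (x \<circ> s) n)) \<longlonglongrightarrow> pairing \<Lambda> c 0"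
    by (rule continuous_on_tendsto_compose[OF continuous_on_pairing[of UNIV] diff]) auto
  then have "(\<lambda>n. J ((x \<circ> s) n) + Re (pairing \<Lambda> c (q - (x \<circ> s) n)) + norm (q - (x \<circ> s) n) * I)
      \<longlonglongrightarrow> L + Re (pairing \<Lambda> c 0) + norm (0 :: (int ^ 'd) \<Rightarrow>\<^sub>0 complex) * I"
    by (intro tendsto_intros J diff)
  then have "J q \<le> L + Re (pairing \<Lambda> c 0) + norm (0 :: (int ^ 'd) \<Rightarrow>\<^sub>0 complex) * I"
    by (rule LIMSEQ_le_const) (use upper in blast)
  then have "J q \<le> L" by (simp add: pairing_def)
  then show ?thesis using that[OF pos] L by (meson order_trans)
qed

section \<open>Stationarity and the moment condition\<close>

text \<open>No differentiation under the integral is carried out. Minimality and the gradient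
  inequality at \<open>q + t *\<^sub>R h\<close> make \<open>dJ (q + t *\<^sub>R h) h\<close>
  nonnegative for small positive \<open>t\<close>; it exceeds \<open>dJ q h\<close> by at most
  \<open>t * K\<close>, and \<open>t\<close> tends to zero.\<close>

lemma dJ_minimizer_nonneg:
  assumes q: "q \<in> pos_polys \<Lambda>" and min: "\<And>r. r \<in> pos_polys \<Lambda> \<Longrightarrow> J q \<le> J r"
    and h: "h \<in> hermitian_coeffs \<Lambda>"
  shows "0 \<le> dJ q h"
proof -
  obtain m where m: "0 < m" "\<And>\<theta>. m \<le> T q \<theta>"
    using pos_polys_lower_bound[OF q] by blast
  \<comment> \<open>The difference of the two quotients in \<open>dJ\<close> carries the factor
    \<open>t\<close> and the denominator \<open>T q * T (q + t *\<^sub>R h)\<close>, which is at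
    least \<open>m * (m / 2)\<close> as long as \<open>t * norm h \<le> m / 2\<close>.\<close>
  define K where "K = 2 * (norm h)\<^sup>2 / m\<^sup>2 * integral\<^sup>L torus_measure (T p)"
  have "0 \<le> K" unfolding K_def using integral_T_p_nonneg by simp
  have lower: "- (t * K) \<le> dJ q h" if t: "0 < t" "t * norm h \<le> m / 2" for t
  proof -
    have Th: "\<bar>T h \<theta>\<bar> \<le> norm h" for \<theta> using h by (rule abs_T_le)
    have T_eq: "T (q + t *\<^sub>R h) \<theta> = T q \<theta> + t * T h \<theta>" for \<theta>
      by (simp add: trig_poly_add trig_poly_scaleR)
    have half: "m / 2 \<le> T (q + t *\<^sub>R h) \<theta>" for \<theta>
    proof -
      have "\<bar>t * T h \<theta>\<bar> \<le> t * norm h"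
        using t(1) Th[of \<theta>] by (simp add: abs_mult)
      then show ?thesis using t(2) m(2)[of \<theta>] T_eq[of \<theta>] by linarith
    qed
    have "0 < T (q + t *\<^sub>R h) \<theta>" for \<theta> using half[of \<theta>] m(1) by linarith
    then have r: "q + t *\<^sub>R h \<in> pos_polys \<Lambda>"
      using q h by (simp add: pos_polys_def hermitian_add hermitian_scaleR)
    have "0 \<le> t * dJ (q + t *\<^sub>R h) h"
      using min[OF r] dual_functional_gradient_le[OF r q] by (simp add: dJ_scaleR)
    then have "0 \<le> dJ (q + t *\<^sub>R h) h" using t(1) by (simp add: zero_le_mult_iff)
    moreover have "dJ (q + t *\<^sub>R h) h - dJ q h =
        (LINT \<theta>|torus_measure. T p \<theta> * T h \<theta> / T q \<theta> - T p \<theta> * T h \<theta> / T (q + t *\<^sub>R h) \<theta>)"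
      using q r by (simp add: dJ_def integrable_quotient)
    moreover have "\<dots> \<le> (LINT \<theta>|torus_measure. t * (2 * (norm h)\<^sup>2 / m\<^sup>2) * T p \<theta>)"
    proof (intro integral_mono Bochner_Integration.integrable_diff integrable_quotient q r
        integrable_mult_right integrable_T)
      fix \<theta>
      have "T p \<theta> * T h \<theta> / T q \<theta> - T p \<theta> * T h \<theta> / T (q + t *\<^sub>R h) \<theta> =
          t * ((T h \<theta>)\<^sup>2 / (T q \<theta> * T (q + t *\<^sub>R h) \<theta>)) * T p \<theta>"
        using T_nonzero[OF q, of \<theta>] T_nonzero[OF r, of \<theta>] T_eq[of \<theta>]
        by (simp add: field_simps power2_eq_square)
      also have "\<dots> \<le> t * ((norm h)\<^sup>2 / (m * (m / 2))) * T p \<theta>"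
      proof (intro mult_right_mono mult_left_mono frac_le)
        show "(T h \<theta>)\<^sup>2 \<le> (norm h)\<^sup>2" using power_mono[OF Th[of \<theta>], of 2] by simp
        show "m * (m / 2) \<le> T q \<theta> * T (q + t *\<^sub>R h) \<theta>"
          using m half[of \<theta>] by (intro mult_mono) (auto intro: order_trans[OF less_imp_le])
      qed (use m t T_pos[OF p, of \<theta>] in auto)
      finally show "T p \<theta> * T h \<theta> / T q \<theta> - T p \<theta> * T h \<theta> / T (q + t *\<^sub>R h) \<theta> \<le>
          t * (2 * (norm h)\<^sup>2 / m\<^sup>2) * T p \<theta>"
        by (simp add: power2_eq_square mult_ac)
    qed
    moreover have "\<dots> = t * K" by (simp add: K_def)
    ultimately show ?thesis by linarith
  qed
  have "((\<lambda>t. - (t * K)) \<longlongrightarrow> - (0 * K)) (at_right 0)"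
    by (intro tendsto_intros)
  moreover have "\<forall>\<^sub>F t in at_right 0. - (t * K) \<le> dJ q h"
  proof -
    have "((\<lambda>t. t * norm h) \<longlongrightarrow> 0 * norm h) (at_right 0)"
      by (intro tendsto_intros)
    then have "\<forall>\<^sub>F t in at_right 0. t * norm h < m / 2"
      using m(1) by (intro order_tendstoD(2)) auto
    moreover have "\<forall>\<^sub>F t::real in at_right 0. 0 < t" by (simp add: eventually_at_right_less)
    ultimately show ?thesis by eventually_elim (simp add: lower)
  qed
  ultimately have "- (0 * K) \<le> dJ q h"
    by (intro tendsto_upperbound) auto
  then show ?thesis by simp
qed

lemma dJ_minimizer_eq_0:
  assumes "q \<in> pos_polys \<Lambda>" "\<And>r. r \<in> pos_polys \<Lambda> \<Longrightarrow> J q \<le> J r" "h \<in> hermitian_coeffs \<Lambda>"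
  shows "dJ q h = 0"
proof (rule antisym)
  have "0 \<le> dJ q ((- 1) *\<^sub>R h)"
    using assms by (intro dJ_minimizer_nonneg hermitian_scaleR) auto
  then show "dJ q h \<le> 0" unfolding dJ_scaleR by simp
qed (use assms in \<open>rule dJ_minimizer_nonneg\<close>)

text \<open>Only Hermitian directions are admissible, so a single moment is tested with a pair of
  conjugate coefficients at \<open>k\<close> and \<open>- k\<close>. This yields one real equation
  for each complex \<open>a\<close>.\<close>

lemma critical_point_moments:
  assumes q: "q \<in> pos_polys \<Lambda>" and crit: "\<And>h. h \<in> hermitian_coeffs \<Lambda> \<Longrightarrow> dJ q h = 0" and k: "k \<in> \<Lambda>"
  shows "Poly_Mapping.lookup c k = (LINT \<theta>|ratio_measure \<Lambda> p q. exp (\<i> * of_real (freq k \<theta>)))"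
proof -
  define g where "g \<theta> = (T p \<theta> / T q \<theta>) *\<^sub>R exp (\<i> * complex_of_real (freq k \<theta>))" for \<theta>
  have int_g: "integrable torus_measure g"
    unfolding g_def
    by (intro integrable_torus continuous_intros continuous_on_trig_poly continuous_on_freq ballI T_nonzero q)
  define I where "I = integral\<^sup>L torus_measure g"
  have herm: "Poly_Mapping.lookup c (- k) = cnj (Poly_Mapping.lookup c k)"
    using c k by (simp add: dual_cone_def hermitian_coeffs_def)
  have Re_eq: "Re (cnj a * Poly_Mapping.lookup c k) = Re (cnj a * I)" for a
  proof -
    \<comment> \<open>For \<open>k = 0\<close> the two summands merge into the real coefficient
      \<open>a + cnj a\<close>, so no case distinction arises.\<close>
    define h where "h = Poly_Mapping.single k a + Poly_Mapping.single (- k) (cnj a)"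
    have lookup_h: "Poly_Mapping.lookup h i = (if i = k then a else 0) + (if - i = k then cnj a else 0)" for i
      by (auto simp: h_def lookup_add lookup_single when_def)
    have "h \<in> hermitian_coeffs \<Lambda>"
      using k uminus_index[OF k]
      by (auto simp: hermitian_coeffs_def lookup_h in_keys_iff split: if_splits)
    then have "dJ q h = 0" by (rule crit)
    moreover have "Re (pairing \<Lambda> c h) = 2 * Re (cnj a * Poly_Mapping.lookup c k)"
      using k uminus_index by (simp add: h_def pairing_add pairing_single herm)
    moreover have "T p \<theta> * T h \<theta> / T q \<theta> = 2 * Re (cnj a * g \<theta>)" for \<theta>
    proof -
      have "trig_poly \<Lambda> h \<theta> = cnj (cnj a * exp (\<i> * of_real (freq k \<theta>))) + cnj a * exp (\<i> * of_real (freq k \<theta>))"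
        using k uminus_index by (simp add: h_def trig_poly_add trig_poly_single freq_minus exp_cnj)
      then have "T h \<theta> = 2 * Re (cnj a * exp (\<i> * of_real (freq k \<theta>)))"
        by (simp only: plus_complex.simps cnj.simps)
      then show ?thesis by (simp add: g_def field_simps)
    qed
    moreover have "(LINT \<theta>|torus_measure. 2 * Re (cnj a * g \<theta>)) = 2 * Re (cnj a * I)"
    proof -
      have "(LINT \<theta>|torus_measure. Re (cnj a * g \<theta>)) = Re (LINT \<theta>|torus_measure. cnj a * g \<theta>)"
        by (intro integral_Re integrable_mult_right int_g)
      also have "\<dots> = Re (cnj a * I)"
        unfolding I_def by (subst integral_mult_right_zero) (rule refl)
      finally show ?thesis by (simp only: integral_mult_right_zero)
    qed
    ultimately show ?thesis by (simp add: dJ_def)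
  qed
  \<comment> \<open>The choice \<open>a = 1\<close> compares the real parts, and
    \<open>a = \<i>\<close> the imaginary parts.\<close>
  have "Poly_Mapping.lookup c k = I"
    using Re_eq[of 1] Re_eq[of \<i>] by (simp add: complex_eq_iff)
  also have "I = (LINT \<theta>|ratio_measure \<Lambda> p q. exp (\<i> * of_real (freq k \<theta>)))"
    unfolding ratio_measure_def I_def g_def
  proof (rule integral_density[symmetric])
    have "continuous_on UNIV (\<lambda>\<theta>. exp (\<i> * complex_of_real (freq k \<theta>)))"
      by (intro continuous_intros continuous_on_freq)
    then show "(\<lambda>\<theta>. exp (\<i> * complex_of_real (freq k \<theta>))) \<in> borel_measurable torus_measure"
      by (rule borel_measurable_torus_measure)
    have "continuous_on UNIV (\<lambda>\<theta>. T p \<theta> / T q \<theta>)"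
      by (intro continuous_intros continuous_on_trig_poly ballI T_nonzero q)
    then show "(\<lambda>\<theta>. T p \<theta> / T q \<theta>) \<in> borel_measurable torus_measure"
      by (rule borel_measurable_torus_measure)
    show "AE \<theta> in torus_measure. 0 \<le> T p \<theta> / T q \<theta>"
      using T_pos[OF p] T_pos[OF q] by (auto simp: less_imp_le)
  qed
  finally show ?thesis .
qed

end

theorem corollary2p3:
  fixes \<Lambda> :: "(int ^ 'd::finite) set"
    and c p :: "(int ^ 'd) \<Rightarrow>\<^sub>0 complex"
  assumes "CARD('d) \<le> 2"
    and "finite \<Lambda>" and "0 \<in> \<Lambda>" and "uminus ` \<Lambda> = \<Lambda>"
    and "c \<in> dual_cone \<Lambda>" and "p \<in> pos_polys \<Lambda>"
  shows "strictly_convex_on (pos_polys \<Lambda>) (dual_functional \<Lambda> c p) \<and>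
    (\<exists>q \<in> pos_polys \<Lambda>.
      (\<forall>k\<in>\<Lambda>. Poly_Mapping.lookup c k =
         (LINT \<theta>|ratio_measure \<Lambda> p q. exp (\<i> * of_real (freq k \<theta>)))) \<and>
      (\<forall>r. is_arg_min (dual_functional \<Lambda> c p) (\<lambda>r. r \<in> pos_polys \<Lambda>) r \<longleftrightarrow> r = q))"
proof -
  interpret trigonometric_moment_problem \<Lambda> c p
    using assms by unfold_locales
  obtain q where q: "q \<in> pos_polys \<Lambda>" and min: "\<And>r. r \<in> pos_polys \<Lambda> \<Longrightarrow> J q \<le> J r"
    using dual_functional_attains_inf[OF assms(1)] by blast
  have crit: "dJ q h = 0" if "h \<in> hermitian_coeffs \<Lambda>" for h
    using q min that by (rule dJ_minimizer_eq_0)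
  \<comment> \<open>At the minimizer the derivative term of the strict gradient inequality vanishes,
    which gives uniqueness.\<close>
  have less: "J q < J r" if r: "r \<in> pos_polys \<Lambda>" "r \<noteq> q" for r
    using dual_functional_gradient_less[OF q r(1)] r(2)
      crit[OF hermitian_diff[OF pos_hermitian[OF q] pos_hermitian[OF r(1)]]] by simp
  have "is_arg_min J (\<lambda>r. r \<in> pos_polys \<Lambda>) r \<longleftrightarrow> r = q" for r
  proof
    assume "is_arg_min J (\<lambda>r. r \<in> pos_polys \<Lambda>) r"
    then show "r = q" using less[of r] q unfolding is_arg_min_def by blast
  qed (use q min in \<open>auto simp: is_arg_min_def not_less\<close>)
  then show ?thesis
    using strictly_convex_dual_functional q critical_point_moments[OF q crit] by blast
qed

end
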